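(* Let $(A_0,A_1)$ be a quasi-Banach couple and let $(\theta,p)\in(0,1)\times(0,\infty)$. Then, with equality as sets and equivalent quasi-norms, $$(A_0+A_1,A_0\cap A_1)_{\theta,p}=\begin{cases}(A_0,A_1)_{\theta,p}+(A_0,A_1)_{1-\theta,p}, & \theta\le 1/2,\\ (A_0,A_1)_{\theta,p}\cap (A_0,A_1)_{1-\theta,p}, & \theta\ge 1/2.\end{cases}$$
   Context: A quasi-Banach couple $(A_0,A_1)$ consists of two quasi-Banach spaces (complete quasi-normed spaces) continuously embedded in a common Hausdorff topological vector space. For $x\in A_0+A_1$ and $t>0$, $K(x,t,A_0,A_1)=\inf\{\|a_0\|_{A_0}+t\|a_1\|_{A_1}: x=a_0+a_1,\ a_j\in A_j,\ j=0,1\}$. The sum carries the quasi-norm $\|x\|_{A_0+A_1}=K(x,1,A_0,A_1)$ and the intersection carries $\|x\|_{A_0\cap A_1}=\max\{\|x\|_{A_0},\|x\|_{A_1}\}$ (and similarly for sums and intersections of any two spaces of a couple). For $0<\theta<1$ and $0<p<\infty$, $(A_0,A_1)_{\theta,p}$ is the space of all $x\in A_0+A_1$ with $\|x\|_{(A_0,A_1)_{\theta,p}}=\left(\int_0^\infty (t^{-\theta}K(x,t,A_0,A_1))^p\frac{dt}{t}\right)^{1/p}<\infty$. *)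

theory Defs
  imports "HOL-Analysis.Analysis"
begin

text \<open>
  A quasi-normed space is represented by its underlying set together with its quasi-norm, inside an
  ambient real vector space. The values of \<open>qnorm\<close> outside the carrier are irrelevant. Complex
  scalars are covered by restriction of scalars, since no notion below depends on the scalars
  other than through the axioms of a quasi-norm, a subspace and a topological vector space.
\<close>

record 'a qn_space =
  carrier :: "'a set"
  qnorm :: "'a \<Rightarrow> real"

definition quasi_normed_space :: "'a::real_vector qn_space \<Rightarrow> bool" where
  "quasi_normed_space X \<longleftrightarrow>
     subspace (carrier X) \<and>
     (\<forall>x\<in>carrier X. 0 \<le> qnorm X x) \<and>
     (\<forall>x\<in>carrier X. qnorm X x = 0 \<longleftrightarrow> x = 0) \<and>
     (\<forall>c. \<forall>x\<in>carrier X. qnorm X (c *\<^sub>R x) = \<bar>c\<bar> * qnorm X x) \<and>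
     (\<exists>C\<ge>1. \<forall>x\<in>carrier X. \<forall>y\<in>carrier X. qnorm X (x + y) \<le> C * (qnorm X x + qnorm X y))"

definition quasi_banach_space :: "'a::real_vector qn_space \<Rightarrow> bool" where
  "quasi_banach_space X \<longleftrightarrow>
     quasi_normed_space X \<and>
     (\<forall>s :: nat \<Rightarrow> 'a. (\<forall>n. s n \<in> carrier X) \<longrightarrow>
        (\<forall>e>0. \<exists>M. \<forall>m\<ge>M. \<forall>n\<ge>M. qnorm X (s m - s n) < e) \<longrightarrow>
        (\<exists>l\<in>carrier X. (\<lambda>n. qnorm X (s n - l)) \<longlonglongrightarrow> 0))"

text \<open>
  The topology induced by a quasi-norm. The balls of a quasi-norm need not be open, but they
  form a neighbourhood base of this topology.
\<close>

definition qnorm_topology :: "'a::real_vector qn_space \<Rightarrow> 'a topology" where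
  "qnorm_topology X = topology (\<lambda>U. U \<subseteq> carrier X \<and>
     (\<forall>x\<in>U. \<exists>e>0. \<forall>y\<in>carrier X. qnorm X (y - x) < e \<longrightarrow> y \<in> U))"

lemma openin_qnorm_topology:
  "openin (qnorm_topology X) U \<longleftrightarrow> U \<subseteq> carrier X \<and>
     (\<forall>x\<in>U. \<exists>e>0. \<forall>y\<in>carrier X. qnorm X (y - x) < e \<longrightarrow> y \<in> U)"
proof -
  let ?P = "\<lambda>U. U \<subseteq> carrier X \<and>
     (\<forall>x\<in>U. \<exists>e>0. \<forall>y\<in>carrier X. qnorm X (y - x) < e \<longrightarrow> y \<in> U)"
  have "?P (S \<inter> V)" if S: "?P S" and V: "?P V" for S V
  proof (intro conjI ballI)
    show "S \<inter> V \<subseteq> carrier X" using S by blast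
    fix x assume x: "x \<in> S \<inter> V"
    obtain d where d: "d > 0" "\<forall>y\<in>carrier X. qnorm X (y - x) < d \<longrightarrow> y \<in> S"
      using S x by blast
    obtain e where e: "e > 0" "\<forall>y\<in>carrier X. qnorm X (y - x) < e \<longrightarrow> y \<in> V"
      using V x by blast
    show "\<exists>e>0. \<forall>y\<in>carrier X. qnorm X (y - x) < e \<longrightarrow> y \<in> S \<inter> V"
      using d e by (intro exI[of _ "min d e"]) auto
  qed
  moreover have "?P (\<Union>\<K>)" if "\<forall>K\<in>\<K>. ?P K" for \<K>
    using that by (meson Sup_least UnionE UnionI)
  ultimately have "istopology ?P"
    unfolding istopology_def by blast
  then show ?thesis
    by (simp add: qnorm_topology_def topology_inverse')
qed

lemma topspace_qnorm_topology: "topspace (qnorm_topology X) = carrier X"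
proof
  show "topspace (qnorm_topology X) \<subseteq> carrier X"
    using openin_qnorm_topology[of X "topspace (qnorm_topology X)"] by simp
  have "openin (qnorm_topology X) (carrier X)"
    unfolding openin_qnorm_topology by (auto intro: exI[of _ "1::real"])
  then show "carrier X \<subseteq> topspace (qnorm_topology X)"
    by (rule openin_subset)
qed

definition hausdorff_tvs :: "'a::real_vector topology \<Rightarrow> bool" where
  "hausdorff_tvs T \<longleftrightarrow>
     topspace T = UNIV \<and> Hausdorff_space T \<and>
     continuous_map (prod_topology T T) T (\<lambda>(x, y). x + y) \<and>
     continuous_map (prod_topology euclideanreal T) T (\<lambda>(c, x). c *\<^sub>R x)"

definition quasi_banach_couple ::
    "'a::real_vector topology \<Rightarrow> 'a qn_space \<Rightarrow> 'a qn_space \<Rightarrow> bool" where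
  "quasi_banach_couple T A\<^sub>0 A\<^sub>1 \<longleftrightarrow>
     hausdorff_tvs T \<and> quasi_banach_space A\<^sub>0 \<and> quasi_banach_space A\<^sub>1 \<and>
     continuous_map (qnorm_topology A\<^sub>0) T id \<and> continuous_map (qnorm_topology A\<^sub>1) T id"

definition K_functional ::
    "'a::real_vector \<Rightarrow> real \<Rightarrow> 'a qn_space \<Rightarrow> 'a qn_space \<Rightarrow> real" where
  "K_functional x t A\<^sub>0 A\<^sub>1 =
     Inf {qnorm A\<^sub>0 a\<^sub>0 + t * qnorm A\<^sub>1 a\<^sub>1 | a\<^sub>0 a\<^sub>1.
            a\<^sub>0 \<in> carrier A\<^sub>0 \<and> a\<^sub>1 \<in> carrier A\<^sub>1 \<and> x = a\<^sub>0 + a\<^sub>1}"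

definition sum_space :: "'a::real_vector qn_space \<Rightarrow> 'a qn_space \<Rightarrow> 'a qn_space" where
  "sum_space X Y =
     \<lparr>carrier = {x + y | x y. x \<in> carrier X \<and> y \<in> carrier Y},
      qnorm = (\<lambda>x. K_functional x 1 X Y)\<rparr>"

definition inter_space :: "'a::real_vector qn_space \<Rightarrow> 'a qn_space \<Rightarrow> 'a qn_space" where
  "inter_space X Y =
     \<lparr>carrier = carrier X \<inter> carrier Y,
      qnorm = (\<lambda>x. max (qnorm X x) (qnorm Y x))\<rparr>"

definition interp_integral ::
    "'a::real_vector qn_space \<Rightarrow> 'a qn_space \<Rightarrow> real \<Rightarrow> real \<Rightarrow> 'a \<Rightarrow> ennreal" where
  "interp_integral A\<^sub>0 A\<^sub>1 \<theta> p x =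
     (\<integral>\<^sup>+ t\<in>{0<..}. ennreal ((t powr (- \<theta>) * K_functional x t A\<^sub>0 A\<^sub>1) powr p / t) \<partial>lborel)"

definition interp_space ::
    "'a::real_vector qn_space \<Rightarrow> 'a qn_space \<Rightarrow> real \<Rightarrow> real \<Rightarrow> 'a qn_space" where
  "interp_space A\<^sub>0 A\<^sub>1 \<theta> p =
     \<lparr>carrier = {x \<in> carrier (sum_space A\<^sub>0 A\<^sub>1). interp_integral A\<^sub>0 A\<^sub>1 \<theta> p x < \<infinity>},
      qnorm = (\<lambda>x. enn2real (interp_integral A\<^sub>0 A\<^sub>1 \<theta> p x) powr (1 / p))\<rparr>"

text \<open>Equality as sets with equivalent quasi-norms.\<close>

definition equal_equiv :: "'a::real_vector qn_space \<Rightarrow> 'a qn_space \<Rightarrow> bool" where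
  "equal_equiv X Y \<longleftrightarrow>
     carrier X = carrier Y \<and>
     (\<exists>c>0. \<exists>C>0. \<forall>x\<in>carrier X. c * qnorm Y x \<le> qnorm X x \<and> qnorm X x \<le> C * qnorm Y x)"

end

theory Submission imports Defs begin

text \<open>
  Write \<open>\<Sigma>\<close> and \<open>\<Delta>\<close> for the sum and the intersection of the couple. For \<open>t \<le> 1\<close> one has
  \<open>K(x, t, \<Sigma>, \<Delta>) \<approx> K(x, t, A\<^sub>0, A\<^sub>1) + t K(x, 1/t, A\<^sub>0, A\<^sub>1)\<close>, and for \<open>t \<ge> 1\<close> the left-hand side is at
  most \<open>K(x, 1, A\<^sub>0, A\<^sub>1)\<close>. After the substitution \<open>t \<mapsto> 1/t\<close> in the second term, the quasi-norm of
  \<open>(\<Sigma>, \<Delta>)\<^bsub>\<theta>,p\<^esub>\<close> is therefore given by the weight \<open>t\<^bsup>-\<theta>\<^esup>\<close> on \<open>(0, 1]\<close> and \<open>t\<^bsup>-(1-\<theta>)\<^esup>\<close> on \<open>[1, \<infinity>)\<close>, both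
  applied to \<open>K(x, t, A\<^sub>0, A\<^sub>1)\<close>. For \<open>\<theta> \<ge> 1/2\<close> this weight is the larger of \<open>t\<^bsup>-\<theta>\<^esup>\<close> and \<open>t\<^bsup>-(1-\<theta>)\<^esup>\<close>, which
  gives the intersection. For \<open>\<theta> \<le> 1/2\<close> it is the smaller one, and a decomposition
  \<open>x = a\<^sub>0 + a\<^sub>1\<close> that is nearly optimal at \<open>t = 1\<close> exhibits \<open>x\<close> as an element of the sum.
\<close>

section \<open>Weighted integrals over the multiplicative half-line\<close>

text \<open>This is the \<open>p\<close>-th power of the weighted norm, with the domain of
  integration as a parameter, so that the parts below and above 1 can be estimated, and their
  exponents exchanged, separately.\<close>

definition weighted_integral :: "real set \<Rightarrow> real \<Rightarrow> real \<Rightarrow> (real \<Rightarrow> real) \<Rightarrow> ennreal" where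
  "weighted_integral S a p f = (\<integral>\<^sup>+ t\<in>S. ennreal ((t powr (- a) * f t) powr p / t) \<partial>lborel)"

text \<open>A monotone function is Borel. Monotonicity of the K-functional in \<open>t\<close> is
  thus the source of all measurability in the development.\<close>

lemma weighted_measurable:
  assumes f: "mono_on {0<..} f" and S: "S \<in> sets borel" "S \<subseteq> {0<..}"
  shows "(\<lambda>t. ennreal ((t powr (- a) * f t) powr p / t) * indicator S t) \<in> borel_measurable borel"
proof -
  have [measurable]: "f \<in> borel_measurable (restrict_space borel S)"
    by (rule borel_measurable_mono_on_fnc) (rule mono_on_subset[OF f S(2)])
  have [measurable]: "(\<lambda>t. t) \<in> borel_measurable (restrict_space borel S)"
    by (simp add: measurable_restrict_space1)
  have "(\<lambda>t. ennreal ((t powr (- a) * f t) powr p / t)) \<in> borel_measurable (restrict_space borel S)"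
    by measurable
  then show ?thesis
    using S by (subst (asm) borel_measurable_restrict_space_iff_ennreal) auto
qed

lemma weighted_integral_mono:
  assumes "\<And>t. t \<in> S \<Longrightarrow> 0 \<le> f t" "\<And>t. t \<in> S \<Longrightarrow> f t \<le> g t" "S \<subseteq> {0<..}" "0 \<le> p"
  shows "weighted_integral S a p f \<le> weighted_integral S a p g"
  unfolding weighted_integral_def
proof (intro nn_integral_mono)
  fix t
  show "ennreal ((t powr - a * f t) powr p / t) * indicator S t
      \<le> ennreal ((t powr - a * g t) powr p / t) * indicator S t"
  proof (cases "t \<in> S")
    case True
    with assms have "(t powr - a * f t) powr p \<le> (t powr - a * g t) powr p"
      by (intro powr_mono2 mult_left_mono mult_nonneg_nonneg) auto
    then show ?thesis using True assms(3) by (auto intro!: ennreal_leI divide_right_mono)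
  qed simp
qed

lemma weighted_integral_cong:
  assumes "\<And>t. t \<in> S \<Longrightarrow> f t = g t"
  shows "weighted_integral S a p f = weighted_integral S a p g"
  unfolding weighted_integral_def
  by (intro nn_integral_cong) (auto simp: assms indicator_def)

lemma weighted_integral_mono_weight:
  assumes "\<And>t. t \<in> S \<Longrightarrow> 0 \<le> f t" "\<And>t. t \<in> S \<Longrightarrow> t powr (- a) \<le> t powr (- b)"
    "S \<subseteq> {0<..}" "0 \<le> p"
  shows "weighted_integral S a p f \<le> weighted_integral S b p f"
  unfolding weighted_integral_def
proof (intro nn_integral_mono)
  fix t
  show "ennreal ((t powr - a * f t) powr p / t) * indicator S t
      \<le> ennreal ((t powr - b * f t) powr p / t) * indicator S t"
  proof (cases "t \<in> S")
    case True
    with assms have "(t powr - a * f t) powr p \<le> (t powr - b * f t) powr p"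
      by (intro powr_mono2 mult_right_mono mult_nonneg_nonneg) auto
    then show ?thesis using True assms(3) by (auto intro!: ennreal_leI divide_right_mono)
  qed simp
qed

lemma weighted_integral_cmult:
  assumes "mono_on {0<..} f" "S \<in> sets borel" "S \<subseteq> {0<..}" "0 \<le> c"
    and "\<And>t. t \<in> S \<Longrightarrow> 0 \<le> f t"
  shows "weighted_integral S a p (\<lambda>t. c * f t) = ennreal (c powr p) * weighted_integral S a p f"
proof -
  have "weighted_integral S a p (\<lambda>t. c * f t)
      = (\<integral>\<^sup>+ t. ennreal (c powr p) * (ennreal ((t powr (- a) * f t) powr p / t) * indicator S t) \<partial>lborel)"
    unfolding weighted_integral_def
  proof (intro nn_integral_cong)
    fix t
    show "ennreal ((t powr - a * (c * f t)) powr p / t) * indicator S t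
      = ennreal (c powr p) * (ennreal ((t powr (- a) * f t) powr p / t) * indicator S t)"
    proof (cases "t \<in> S")
      case True
      then have "(t powr - a * (c * f t)) powr p = c powr p * (t powr - a * f t) powr p"
        using assms(4,5) by (subst mult.left_commute, subst powr_mult) auto
      then show ?thesis using True assms(3)
        by (auto simp: ennreal_mult[symmetric] subset_iff)
    qed simp
  qed
  also have "\<dots> = ennreal (c powr p) * weighted_integral S a p f"
    unfolding weighted_integral_def
    using weighted_measurable[OF assms(1-3)] by (intro nn_integral_cmult) simp
  finally show ?thesis .
qed

text \<open>From x + y \<le> 2 max(x, y). The constant is not sharp but serves all exponents at
  once, so the cases \<open>p < 1\<close> and \<open>p \<ge> 1\<close> need no separation.\<close>

lemma powr_add_le:
  fixes x y p :: real
  assumes "0 \<le> x" "0 \<le> y" "0 \<le> p"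
  shows "(x + y) powr p \<le> 2 powr p * (x powr p + y powr p)"
proof -
  have "(x + y) powr p \<le> (2 * max x y) powr p"
    using assms by (intro powr_mono2) auto
  also have "\<dots> = 2 powr p * max x y powr p"
    using assms by (simp add: powr_mult)
  also have "\<dots> \<le> 2 powr p * (x powr p + y powr p)"
    by (intro mult_left_mono) (auto simp: max_def)
  finally show ?thesis .
qed

lemma weighted_integral_add:
  assumes fg: "mono_on {0<..} f" "mono_on {0<..} g" and S: "S \<in> sets borel" "S \<subseteq> {0<..}"
    and nn: "\<And>t. t \<in> S \<Longrightarrow> 0 \<le> f t" "\<And>t. t \<in> S \<Longrightarrow> 0 \<le> g t" and p: "0 \<le> p"
  shows "weighted_integral S a p (\<lambda>t. f t + g t)
    \<le> ennreal (2 powr p) * (weighted_integral S a p f + weighted_integral S a p g)"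
proof -
  let ?F = "\<lambda>f t. ennreal ((t powr (- a) * f t) powr p / t) * indicator S t"
  note [measurable] = weighted_measurable[OF fg(1) S, of a p] weighted_measurable[OF fg(2) S, of a p]
  have "weighted_integral S a p (\<lambda>t. f t + g t)
      \<le> (\<integral>\<^sup>+ t. ennreal (2 powr p) * (?F f t + ?F g t) \<partial>lborel)"
    unfolding weighted_integral_def
  proof (intro nn_integral_mono)
    fix t
    show "?F (\<lambda>t. f t + g t) t \<le> ennreal (2 powr p) * (?F f t + ?F g t)"
    proof (cases "t \<in> S")
      case True
      then have "t > 0" using S by auto
      have "(t powr - a * (f t + g t)) powr p
          \<le> 2 powr p * ((t powr - a * f t) powr p + (t powr - a * g t) powr p)"
        using nn True p by (subst distrib_left, intro powr_add_le) auto
      then have "(t powr - a * (f t + g t)) powr p / t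
          \<le> 2 powr p * ((t powr - a * f t) powr p / t + (t powr - a * g t) powr p / t)"
        using \<open>t > 0\<close> by (simp add: field_simps)
      then show ?thesis using True \<open>t > 0\<close>
        by (simp add: ennreal_mult[symmetric] ennreal_plus[symmetric] ennreal_leI del: ennreal_plus)
    qed simp
  qed
  also have "\<dots> = ennreal (2 powr p) * (weighted_integral S a p f + weighted_integral S a p g)"
    unfolding weighted_integral_def by (simp add: nn_integral_cmult nn_integral_add)
  finally show ?thesis .
qed

lemma weighted_integral_split:
  assumes "mono_on {0<..} f"
  shows "weighted_integral {0<..} a p f = weighted_integral {0<..1} a p f + weighted_integral {1..} a p f"
proof -
  let ?F = "\<lambda>t. ennreal ((t powr (- a) * f t) powr p / t)"
  have "weighted_integral {0<..} a p f
      = (\<integral>\<^sup>+ t. ?F t * indicator {0<..1} t + ?F t * indicator {1..} t \<partial>lborel)"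
    unfolding weighted_integral_def
    \<comment> \<open>The point 1 belongs to both pieces, so the integrands agree only off a null
      set.\<close>
    by (intro nn_integral_cong_AE, rule AE_mp[OF AE_lborel_singleton[of 1]])
       (auto simp: indicator_def)
  also have "\<dots> = weighted_integral {0<..1} a p f + weighted_integral {1..} a p f"
    unfolding weighted_integral_def
    using weighted_measurable[OF assms, of "{0<..1}" a p] weighted_measurable[OF assms, of "{1..}" a p]
    by (intro nn_integral_add) (auto simp: subset_iff)
  finally show ?thesis .
qed

section \<open>The substitution t -> 1/t\<close>

text \<open>The substitution rule asks for a nonnegative derivative, while 1/t decreases. The
  integral is therefore first reflected to the negative half-line, and then the increasing map -1/x
  with derivative 1/x^2 is substituted.\<close>

lemma nn_integral_inverse_interval:
  fixes h :: "real \<Rightarrow> real" and b :: real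
  assumes h: "set_borel_measurable borel {1..} h" and b: "1 \<le> b"
  shows "(\<integral>\<^sup>+ s\<in>{1..b}. ennreal (h s) \<partial>lborel) =
    (\<integral>\<^sup>+ t\<in>{1 / b..1}. ennreal (h (1 / t) / t\<^sup>2) \<partial>lborel)"
proof -
  have [measurable]: "(\<lambda>s. indicator {1..} s * h s) \<in> borel_measurable borel"
    using h by (simp add: set_borel_measurable_def)
  have "(\<lambda>y. indicator {-b..-1} y * (indicator {1..} (- y) * h (- y))) \<in> borel_measurable borel"
    by measurable
  also have "(\<lambda>y. indicator {-b..-1} y * (indicator {1..} (- y) * h (- y)))
      = (\<lambda>y. indicator {-b..-1} y * h (- y))"
    by (auto simp: indicator_def fun_eq_iff)
  finally have m: "set_borel_measurable borel {- 1 / (1 / b) .. - 1 / 1} (\<lambda>y. h (- y))"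
    by (simp add: set_borel_measurable_def)
  have "(\<integral>\<^sup>+ s\<in>{1..b}. ennreal (h s) \<partial>lborel)
      = (\<integral>\<^sup>+ y. ennreal (h y * indicator {1..b} y) \<partial>distr lborel borel uminus)"
    by (subst lborel_distr_uminus) (auto intro!: nn_integral_cong simp: indicator_def)
  also have "\<dots> = (\<integral>\<^sup>+ y. ennreal (h (- y) * indicator {- 1 / (1 / b) .. - 1 / 1} y) \<partial>lborel)"
  proof -
    have "(\<lambda>s. indicator {..b} s * (indicator {1..} s * h s)) \<in> borel_measurable borel"
      by measurable
    also have "(\<lambda>s. indicator {..b} s * (indicator {1..} s * h s)) = (\<lambda>s. h s * indicator {1..b} s)"
      by (auto simp: indicator_def fun_eq_iff)
    finally have [measurable]: "(\<lambda>s. h s * indicator {1..b} s) \<in> borel_measurable borel" .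
    show ?thesis
      by (subst nn_integral_distr, simp, simp) (auto intro!: nn_integral_cong simp: indicator_def)
  qed
  also have "\<dots> = (\<integral>\<^sup>+ t. ennreal (h (- (- 1 / t)) * (1 / t\<^sup>2) * indicator {1 / b..1} t) \<partial>lborel)"
  proof (rule nn_integral_substitution[where g = "\<lambda>x. - 1 / x", OF m])
    show "((\<lambda>x. - 1 / x) has_real_derivative 1 / x\<^sup>2) (at x)" if "x \<in> {1 / b..1}" for x
    proof -
      have "x > 0" using that b by (auto intro: less_le_trans[of 0 "1 / b"])
      then show ?thesis
        by (auto intro!: derivative_eq_intros simp: power2_eq_square)
    qed
    show "continuous_on {1 / b..1} (\<lambda>x. 1 / x\<^sup>2)"
      using b by (intro continuous_intros ballI) (auto simp: not_le)
  qed (use b in auto)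
  also have "\<dots> = (\<integral>\<^sup>+ t\<in>{1 / b..1}. ennreal (h (1 / t) / t\<^sup>2) \<partial>lborel)"
    by (auto intro!: nn_integral_cong simp: indicator_def)
  finally show ?thesis .
qed

text \<open>The intervals [1, 1 + n] exhaust [1, \<infinity>) while their images [1/(1 + n), 1]
  exhaust (0, 1]. Reading both integrals as measures given by densities turns the limit into
  continuity from below.\<close>

lemma nn_integral_inverse:
  fixes h :: "real \<Rightarrow> real"
  assumes h: "set_borel_measurable borel {1..} h"
  shows "(\<integral>\<^sup>+ s\<in>{1..}. ennreal (h s) \<partial>lborel) =
    (\<integral>\<^sup>+ t\<in>{0<..1}. ennreal (h (1 / t) / t\<^sup>2) \<partial>lborel)"
proof -
  have [measurable]: "(\<lambda>s. indicator {1..} s * h s) \<in> borel_measurable borel"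
    using h by (simp add: set_borel_measurable_def)
  \<comment> \<open>\<open>h\<close> is measurable only on [1, \<infinity>); the indicators inside
    the densities make them measurable on the whole line.\<close>
  define F where "F s = ennreal (indicator {1..} s * h s)" for s
  define G where "G t = ennreal (indicator {1..} (1 / t) * h (1 / t) / t\<^sup>2)" for t
  have [measurable]: "F \<in> borel_measurable borel" "G \<in> borel_measurable borel"
    unfolding F_def G_def by measurable
  define A where "A n = {1..1 + real n}" for n
  define B where "B n = {1 / (1 + real n)..1}" for n
  have pos: "0 < t" if "1 / (1 + real n) \<le> t" for t n
    using that by (rule less_le_trans[rotated]) simp
  have F: "emeasure (density lborel F) S = (\<integral>\<^sup>+ s\<in>S. ennreal (h s) \<partial>lborel)"
    if "S \<in> sets borel" "S \<subseteq> {1..}" for S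
    using that by (subst emeasure_density) (auto intro!: nn_integral_cong simp: F_def indicator_def)
  have G: "emeasure (density lborel G) S = (\<integral>\<^sup>+ t\<in>S. ennreal (h (1 / t) / t\<^sup>2) \<partial>lborel)"
    if "S \<in> sets borel" "S \<subseteq> {0<..1}" for S
    using that by (subst emeasure_density) (auto intro!: nn_integral_cong simp: G_def indicator_def)
  have UA: "(\<Union>n. A n) = {1..}"
  proof (intro subset_antisym subsetI)
    fix s :: real assume "s \<in> {1..}"
    moreover obtain n where "s < real n" using reals_Archimedean2 by blast
    ultimately show "s \<in> (\<Union>n. A n)" by (auto simp: A_def intro!: exI[of _ n])
  qed (auto simp: A_def)
  have UB: "(\<Union>n. B n) = {0<..1}"
  proof (intro subset_antisym subsetI)
    fix t :: real assume t: "t \<in> {0<..1}"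
    moreover obtain n where "1 / t < real n" using reals_Archimedean2 by blast
    ultimately have "1 / (1 + real n) \<le> t" by (simp add: field_simps)
    then show "t \<in> (\<Union>n. B n)" using t by (auto simp: B_def)
  qed (auto simp: B_def dest: pos)
  have "(\<integral>\<^sup>+ s\<in>{1..}. ennreal (h s) \<partial>lborel) = emeasure (density lborel F) (\<Union>n. A n)"
    by (simp add: F UA)
  also have "\<dots> = (SUP n. emeasure (density lborel F) (A n))"
    by (rule SUP_emeasure_incseq[symmetric]) (auto simp: A_def incseq_def)
  also have "\<dots> = (SUP n. emeasure (density lborel G) (B n))"
  proof (rule SUP_cong)
    fix n
    show "emeasure (density lborel F) (A n) = emeasure (density lborel G) (B n)"
      using nn_integral_inverse_interval[OF h, of "1 + real n"]
      by (subst F, auto simp: A_def, subst G, auto simp: B_def dest: pos)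
  qed simp
  also have "\<dots> = emeasure (density lborel G) (\<Union>n. B n)"
  proof (rule SUP_emeasure_incseq)
    have "1 / (1 + real n) \<le> 1 / (1 + real m)" if "m \<le> n" for m n
      using that by (intro divide_left_mono) auto
    then show "incseq B" by (auto simp: B_def incseq_def intro: order_trans)
  qed (auto simp: B_def)
  also have "\<dots> = (\<integral>\<^sup>+ t\<in>{0<..1}. ennreal (h (1 / t) / t\<^sup>2) \<partial>lborel)"
    by (simp add: G UB)
  finally show ?thesis .
qed

text \<open>Inversion preserves dt/t and turns t^(-a) into t^a = t^(-(1-a)) t. The surplus factor t
  is put with f(1/t), because t K(x, 1/t) is the K-functional of the reversed couple.\<close>

lemma weighted_integral_inverse:
  assumes f: "mono_on {0<..} f"
  shows "weighted_integral {1..} a p f = weighted_integral {0<..1} (1 - a) p (\<lambda>t. t * f (1 / t))"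
proof -
  define h where "h t = (t powr (- a) * f t) powr p / t" for t
  have "f \<in> borel_measurable (restrict_space borel {1..})"
    by (rule borel_measurable_mono_on_fnc) (rule mono_on_subset[OF f], auto)
  moreover have "(\<lambda>t. t) \<in> borel_measurable (restrict_space borel {1::real..})"
    by (simp add: measurable_restrict_space1)
  ultimately have "h \<in> borel_measurable (restrict_space borel {1..})"
    unfolding h_def by measurable
  then have h: "set_borel_measurable borel {1..} h"
    by (simp add: set_borel_measurable_def borel_measurable_restrict_space_iff)
  have "h (1 / t) / t\<^sup>2 = (t powr (- (1 - a)) * (t * f (1 / t))) powr p / t" if "t > 0" for t
  proof -
    have "(1 / t) powr (- a) = t powr a"
      using that by (simp add: powr_divide powr_minus_divide)
    moreover have "t powr (- (1 - a)) * t = t powr a"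
      using that powr_add[of t "- (1 - a)" 1] by simp
    ultimately show ?thesis
      using that by (simp add: h_def power2_eq_square mult.assoc[symmetric])
  qed
  then show ?thesis
    using nn_integral_inverse[OF h] unfolding weighted_integral_def h_def
    by (auto intro!: nn_integral_cong simp: indicator_def)
qed

text \<open>The integrand is t^(-ap-1), with antiderivative -t^(-ap)/(ap).\<close>

lemma weighted_integral_one:
  assumes "0 < a" "0 < p"
  shows "weighted_integral {1..} a p (\<lambda>_. 1) = ennreal (1 / (a * p))"
proof -
  have "weighted_integral {1..} a p (\<lambda>_. 1)
      = (\<integral>\<^sup>+ t. ennreal (t powr (- (a * p) - 1)) * indicator {1..} t \<partial>lborel)"
    unfolding weighted_integral_def
    by (intro nn_integral_cong) (auto simp: indicator_def powr_powr powr_diff)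
  also have "\<dots> = ennreal (0 - (- (1 powr (- (a * p)) / (a * p))))"
  proof (rule nn_integral_FTC_atLeast[where F = "\<lambda>t. - (t powr (- (a * p)) / (a * p))"])
    show "((\<lambda>t. - (t powr (- (a * p)) / (a * p))) \<longlongrightarrow> 0) at_top"
      using tendsto_minus[OF tendsto_divide[OF tendsto_neg_powr[of "- (a * p)" "\<lambda>t. t" at_top]
          tendsto_const[of "a * p"]]] assms
      by (simp add: filterlim_ident)
  qed (use assms in \<open>auto intro!: derivative_eq_intros simp: powr_diff field_simps\<close>)
  finally show ?thesis by simp
qed

section \<open>The K-functional\<close>

text \<open>Isolating nonnegativity lets the basic estimates of the K-functional apply to sums,
  intersections and interpolation spaces without first proving these to be quasi-normed.\<close>

definition qnorm_nonneg :: "'a qn_space \<Rightarrow> bool" where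
  "qnorm_nonneg X \<longleftrightarrow> (\<forall>a\<in>carrier X. 0 \<le> qnorm X a)"

lemma mem_carrier_sum_space:
  "x \<in> carrier (sum_space X Y) \<longleftrightarrow> (\<exists>a\<in>carrier X. \<exists>b\<in>carrier Y. x = a + b)"
  by (auto simp: sum_space_def)

lemma qnorm_sum_space: "qnorm (sum_space X Y) x = K_functional x 1 X Y"
  by (simp add: sum_space_def)

lemma K_functional_le:
  assumes "qnorm_nonneg X" "qnorm_nonneg Y" "0 \<le> t" "a \<in> carrier X" "b \<in> carrier Y"
  shows "K_functional (a + b) t X Y \<le> qnorm X a + t * qnorm Y b"
  unfolding K_functional_def
proof (rule cInf_lower)
  show "bdd_below {qnorm X a\<^sub>0 + t * qnorm Y a\<^sub>1 |a\<^sub>0 a\<^sub>1.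
      a\<^sub>0 \<in> carrier X \<and> a\<^sub>1 \<in> carrier Y \<and> a + b = a\<^sub>0 + a\<^sub>1}"
    using assms(1-3) by (intro bdd_belowI[of _ 0]) (auto simp: qnorm_nonneg_def)
qed (use assms in blast)

text \<open>Membership in the sum makes the set of costs nonempty, so that its real
  \<open>Inf\<close> is a genuine greatest lower bound.\<close>

lemma K_functional_greatest:
  assumes "x \<in> carrier (sum_space X Y)"
    and "\<And>a b. a \<in> carrier X \<Longrightarrow> b \<in> carrier Y \<Longrightarrow> x = a + b \<Longrightarrow> m \<le> qnorm X a + t * qnorm Y b"
  shows "m \<le> K_functional x t X Y"
  unfolding K_functional_def using assms by (intro cInf_greatest) (auto simp: mem_carrier_sum_space)

lemma K_functional_nonneg:
  assumes "qnorm_nonneg X" "qnorm_nonneg Y" "0 \<le> t" "x \<in> carrier (sum_space X Y)"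
  shows "0 \<le> K_functional x t X Y"
  using assms by (intro K_functional_greatest) (auto simp: qnorm_nonneg_def)

lemma K_functional_approx:
  assumes "x \<in> carrier (sum_space X Y)" "e > 0"
  obtains a b where "a \<in> carrier X" "b \<in> carrier Y" "x = a + b"
    "qnorm X a + t * qnorm Y b < K_functional x t X Y + e"
proof -
  have "\<not> K_functional x t X Y + e \<le> K_functional x t X Y"
    using assms by simp
  then show thesis
    using K_functional_greatest[OF assms(1)] that by (meson not_le)
qed

lemma K_functional_mono:
  assumes "qnorm_nonneg X" "qnorm_nonneg Y" "x \<in> carrier (sum_space X Y)" "0 \<le> s" "s \<le> t"
  shows "K_functional x s X Y \<le> K_functional x t X Y"
proof (rule K_functional_greatest[OF assms(3)])
  fix a b assume ab: "a \<in> carrier X" "b \<in> carrier Y" "x = a + b"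
  have "K_functional x s X Y \<le> qnorm X a + s * qnorm Y b"
    using ab assms by (auto intro!: K_functional_le)
  also have "\<dots> \<le> qnorm X a + t * qnorm Y b"
    using ab assms by (auto simp: qnorm_nonneg_def intro!: mult_right_mono)
  finally show "K_functional x s X Y \<le> qnorm X a + t * qnorm Y b" .
qed

text \<open>For t \<le> 1, t(|a| + |b|) \<le> |a| + t|b| for each decomposition. This lower bound
  near 0 is what later lets the part on (0, 1] control K(x, 1).\<close>

lemma K_functional_scale_le:
  assumes "qnorm_nonneg X" "qnorm_nonneg Y" "x \<in> carrier (sum_space X Y)" "0 \<le> t" "t \<le> 1"
  shows "t * K_functional x 1 X Y \<le> K_functional x t X Y"
proof (rule K_functional_greatest[OF assms(3)])
  fix a b assume ab: "a \<in> carrier X" "b \<in> carrier Y" "x = a + b"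
  have "t * K_functional x 1 X Y \<le> t * (qnorm X a + 1 * qnorm Y b)"
    unfolding ab(3) using ab assms by (intro mult_left_mono K_functional_le) auto
  also have "\<dots> \<le> qnorm X a + t * qnorm Y b"
    using ab assms by (auto simp: qnorm_nonneg_def distrib_left intro!: mult_left_le_one_le)
  finally show "t * K_functional x 1 X Y \<le> qnorm X a + t * qnorm Y b" .
qed

lemma sum_space_commute: "sum_space X Y = sum_space Y X"
proof -
  have "K_functional x 1 X Y = K_functional x 1 Y X" for x
    unfolding K_functional_def
    by (rule arg_cong[of _ _ Inf], auto) (metis add.commute)+
  moreover have "carrier (sum_space X Y) = carrier (sum_space Y X)"
    by (auto simp: mem_carrier_sum_space) (metis add.commute)+
  ultimately show ?thesis by (simp add: sum_space_def)
qed

lemma inter_space_commute: "inter_space X Y = inter_space Y X"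
  by (simp add: inter_space_def max.commute Int_commute)

text \<open>Each decomposition satisfies t(|a| + |b|/t) = |b| + t|a|. One inequality is shown for
  every couple; the other is the same inequality for the reversed couple at 1/t.\<close>

lemma K_functional_swap:
  assumes "qnorm_nonneg X" "qnorm_nonneg Y" "x \<in> carrier (sum_space X Y)" "t > 0"
  shows "K_functional x t Y X = t * K_functional x (1 / t) X Y"
proof -
  have le: "s * K_functional x (1 / s) X Y \<le> K_functional x s Y X"
    if "qnorm_nonneg X" "qnorm_nonneg Y" "x \<in> carrier (sum_space X Y)" "s > 0"
    for s and X Y :: "'a qn_space"
  proof (rule K_functional_greatest)
    fix b a assume ab: "b \<in> carrier Y" "a \<in> carrier X" "x = b + a"
    have "s * K_functional x (1 / s) X Y \<le> s * (qnorm X a + (1 / s) * qnorm Y b)"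
      unfolding ab(3) add.commute[of b a]
      using that ab by (intro mult_left_mono K_functional_le) auto
    then show "s * K_functional x (1 / s) X Y \<le> qnorm Y b + s * qnorm X a"
      using \<open>s > 0\<close> by (simp add: distrib_left)
  qed (use that in \<open>simp add: sum_space_commute\<close>)
  show ?thesis
  proof (rule antisym)
    show "t * K_functional x (1 / t) X Y \<le> K_functional x t Y X"
      using assms le by blast
    have "1 / t * K_functional x (1 / (1 / t)) Y X \<le> K_functional x (1 / t) X Y"
      using assms by (intro le) (auto simp: sum_space_commute)
    then show "K_functional x t Y X \<le> t * K_functional x (1 / t) X Y"
      using \<open>t > 0\<close> by (simp add: field_simps)
  qed
qed

section \<open>Couples of quasi-normed spaces\<close>

text \<open>One constant \<open>C\<close> for both triangle inequalities keeps the locale symmetric,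
  so \<open>swap\<close> yields every result for the reversed couple as well.\<close>

locale quasi_normed_pair =
  fixes X Y :: "'a::real_vector qn_space" and C :: real
  assumes normed: "quasi_normed_space X" "quasi_normed_space Y"
    and C_ge_1: "1 \<le> C"
    and triangle: "\<And>a b. a \<in> carrier X \<Longrightarrow> b \<in> carrier X \<Longrightarrow>
        qnorm X (a + b) \<le> C * (qnorm X a + qnorm X b)"
      "\<And>a b. a \<in> carrier Y \<Longrightarrow> b \<in> carrier Y \<Longrightarrow>
        qnorm Y (a + b) \<le> C * (qnorm Y a + qnorm Y b)"
begin

lemma swap: "quasi_normed_pair Y X C"
  using normed C_ge_1 triangle by unfold_locales

lemma nonneg: "qnorm_nonneg X" "qnorm_nonneg Y"
  using normed by (auto simp: qnorm_nonneg_def quasi_normed_space_def)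

lemma subspaces: "subspace (carrier X)" "subspace (carrier Y)"
  using normed by (auto simp: quasi_normed_space_def)

lemma zero_mem: "0 \<in> carrier X" "0 \<in> carrier Y"
  using subspaces subspace_0 by auto

lemma qnorm_zero: "qnorm X 0 = 0" "qnorm Y 0 = 0"
  using normed zero_mem by (auto simp: quasi_normed_space_def)

lemma qnorm_minus: "a \<in> carrier X \<Longrightarrow> qnorm X (- a) = qnorm X a"
  using normed(1) unfolding quasi_normed_space_def by (metis abs_1 abs_minus mult_1 scaleR_minus1_left)

lemma qnorm_diff_le:
  assumes "a \<in> carrier X" "b \<in> carrier X"
  shows "qnorm X (a - b) \<le> C * (qnorm X a + qnorm X b)"
  using triangle(1)[of a "- b"] assms subspaces qnorm_minus by (simp add: subspace_neg)

lemma C_nonneg: "0 \<le> C"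
  using C_ge_1 by simp

lemma carrier_subset_sum: "carrier X \<subseteq> carrier (sum_space X Y)"
  using zero_mem unfolding mem_carrier_sum_space subset_iff by (metis add.right_neutral)

lemma sum_subspace: "subspace (carrier (sum_space X Y))"
proof -
  have "carrier (sum_space X Y) = {x + y |x y. x \<in> carrier X \<and> y \<in> carrier Y}"
    by (simp add: sum_space_def)
  then show ?thesis using subspace_sums[OF subspaces] by simp
qed

text \<open>Nearly optimal decompositions of \<open>x\<close> and \<open>y\<close> are added
  componentwise. The shared \<open>C\<close> can be factored out of both components.\<close>

lemma K_functional_add:
  assumes x: "x \<in> carrier (sum_space X Y)" and y: "y \<in> carrier (sum_space X Y)" and t: "0 \<le> t"
  shows "K_functional (x + y) t X Y \<le> C * (K_functional x t X Y + K_functional y t X Y)"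
proof -
  have le: "K_functional (x + y) t X Y \<le> C * ((K_functional x t X Y + K_functional y t X Y) + e)"
    if "e > 0" for e
  proof -
    obtain a b where ab: "a \<in> carrier X" "b \<in> carrier Y" "x = a + b"
      "qnorm X a + t * qnorm Y b < K_functional x t X Y + e / 2"
      by (rule K_functional_approx[OF x, of "e / 2"]) (use \<open>e > 0\<close> in auto)
    obtain c d where cd: "c \<in> carrier X" "d \<in> carrier Y" "y = c + d"
      "qnorm X c + t * qnorm Y d < K_functional y t X Y + e / 2"
      by (rule K_functional_approx[OF y, of "e / 2"]) (use \<open>e > 0\<close> in auto)
    have "K_functional (x + y) t X Y = K_functional ((a + c) + (b + d)) t X Y"
      using ab cd by (simp add: algebra_simps)
    also have "\<dots> \<le> qnorm X (a + c) + t * qnorm Y (b + d)"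
      using ab cd t nonneg subspaces by (intro K_functional_le) (auto intro: subspace_add)
    also have "\<dots> \<le> C * (qnorm X a + qnorm X c) + t * (C * (qnorm Y b + qnorm Y d))"
      using ab cd t triangle by (intro add_mono mult_left_mono) auto
    also have "\<dots> = C * ((qnorm X a + t * qnorm Y b) + (qnorm X c + t * qnorm Y d))"
      by (simp add: algebra_simps)
    also have "\<dots> \<le> C * ((K_functional x t X Y + K_functional y t X Y) + e)"
      using ab cd by (intro mult_left_mono C_nonneg) auto
    finally show ?thesis .
  qed
  show ?thesis
  proof (rule field_le_epsilon)
    fix e :: real assume "e > 0"
    then show "K_functional (x + y) t X Y \<le> C * (K_functional x t X Y + K_functional y t X Y) + e"
      using le[of "e / C"] C_ge_1 by (simp add: distrib_left)
  qed
qed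

lemma K_functional_le_left:
  assumes "a \<in> carrier X" "0 \<le> t" shows "K_functional a t X Y \<le> qnorm X a"
  using K_functional_le[OF nonneg assms(2,1) zero_mem(2)] by (simp add: qnorm_zero)

lemma K_functional_le_right:
  assumes "b \<in> carrier Y" "0 \<le> t" shows "K_functional b t X Y \<le> t * qnorm Y b"
  using K_functional_le[OF nonneg assms(2) zero_mem(1) assms(1)] by (simp add: qnorm_zero)

lemma nonneg_sum: "qnorm_nonneg (sum_space X Y)"
  unfolding qnorm_nonneg_def[of "sum_space X Y"] qnorm_sum_space
  using nonneg by (auto intro!: K_functional_nonneg)

lemma nonneg_inter: "qnorm_nonneg (inter_space X Y)"
  using nonneg by (auto simp: inter_space_def qnorm_nonneg_def le_max_iff_disj)

lemma zero_mem_inter: "0 \<in> carrier (inter_space X Y)"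
  using zero_mem by (simp add: inter_space_def)

section \<open>The K-functional of the sum and the intersection\<close>

text \<open>The intersection already lies in the sum, so adding it gives no new elements.\<close>

lemma carrier_sum_inter:
  "carrier (sum_space (sum_space X Y) (inter_space X Y)) = carrier (sum_space X Y)"
proof (intro subset_antisym subsetI)
  fix x assume "x \<in> carrier (sum_space (sum_space X Y) (inter_space X Y))"
  then obtain u v where uv: "u \<in> carrier (sum_space X Y)" "v \<in> carrier X" "x = u + v"
    by (auto simp: mem_carrier_sum_space[of _ "sum_space X Y"] inter_space_def)
  then show "x \<in> carrier (sum_space X Y)"
    using carrier_subset_sum sum_subspace by (auto intro: subspace_add)
next
  fix x assume "x \<in> carrier (sum_space X Y)"
  then show "x \<in> carrier (sum_space (sum_space X Y) (inter_space X Y))"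
    unfolding mem_carrier_sum_space[of _ "sum_space X Y"]
    using zero_mem_inter by (metis add.right_neutral)
qed

lemma K_sum_inter_le_one:
  assumes x: "x \<in> carrier (sum_space X Y)" and t: "0 \<le> t"
  shows "K_functional x t (sum_space X Y) (inter_space X Y) \<le> K_functional x 1 X Y"
  using K_functional_le[OF nonneg_sum nonneg_inter t x zero_mem_inter]
  by (simp add: qnorm_sum_space) (simp add: inter_space_def qnorm_zero)

text \<open>
  If \<open>x = a\<^sub>0 + a\<^sub>1 = b\<^sub>0 + b\<^sub>1\<close> are nearly optimal for \<open>K(x, t)\<close> and \<open>K(x, 1/t)\<close> respectively,
  then \<open>b\<^sub>0 - a\<^sub>0 = a\<^sub>1 - b\<^sub>1\<close> lies in the intersection, and \<open>x = (a\<^sub>0 + b\<^sub>1) + (b\<^sub>0 - a\<^sub>0)\<close>.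
\<close>

lemma K_sum_inter_le:
  assumes x: "x \<in> carrier (sum_space X Y)" and t: "0 \<le> t" "t \<le> 1"
  shows "K_functional x t (sum_space X Y) (inter_space X Y)
     \<le> 2 * C * (K_functional x t X Y + K_functional x t Y X)"
proof -
  interpret Y: quasi_normed_pair Y X C by (rule swap)
  have le: "K_functional x t (sum_space X Y) (inter_space X Y)
     \<le> 2 * C * ((K_functional x t X Y + K_functional x t Y X) + e)" if "e > 0" for e
  proof -
    obtain a0 a1 where a: "a0 \<in> carrier X" "a1 \<in> carrier Y" "x = a0 + a1"
      "qnorm X a0 + t * qnorm Y a1 < K_functional x t X Y + e / 2"
      by (rule K_functional_approx[OF x, of "e / 2"]) (use \<open>e > 0\<close> in auto)
    \<comment> \<open>Since K(x, t) for the reversed couple is t K(x, 1/t), the second decomposition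
      is taken from the reversed couple at the same \<open>t\<close>.\<close>
    have x': "x \<in> carrier (sum_space Y X)" using x by (simp add: sum_space_commute)
    obtain b1 b0 where b: "b1 \<in> carrier Y" "b0 \<in> carrier X" "x = b1 + b0"
      "qnorm Y b1 + t * qnorm X b0 < K_functional x t Y X + e / 2"
      by (rule K_functional_approx[OF x', of "e / 2"]) (use \<open>e > 0\<close> in auto)
    have n: "0 \<le> qnorm X a0" "0 \<le> qnorm Y a1" "0 \<le> qnorm Y b1" "0 \<le> qnorm X b0"
      using a b nonneg by (auto simp: qnorm_nonneg_def)
    \<comment> \<open>The total cost of both decompositions. The bounds 3 and 4 below estimate each
      of the two parts of \<open>x\<close> by \<open>C * s\<close>, using t \<le> 1 where a term
      enters \<open>s\<close> without the factor \<open>t\<close>.\<close>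
    define s where "s = qnorm X a0 + t * qnorm Y a1 + qnorm Y b1 + t * qnorm X b0"
    define v where "v = b0 - a0"
    have v': "v = a1 - b1" using a b by (simp add: v_def algebra_simps)
    have v: "v \<in> carrier X"
      unfolding v_def using a b subspaces by (auto intro: subspace_diff)
    have vY: "v \<in> carrier Y"
      unfolding v' using a b subspaces by (auto intro: subspace_diff)
    have "t * qnorm X v \<le> t * (C * (qnorm X b0 + qnorm X a0))"
      unfolding v_def using a b t by (intro mult_left_mono qnorm_diff_le)
    also have "\<dots> = C * (t * qnorm X b0 + t * qnorm X a0)"
      by (simp add: algebra_simps)
    also have "\<dots> \<le> C * s"
      unfolding s_def using n t C_nonneg mult_left_le_one_le[of "qnorm X a0" t]
      by (intro mult_left_mono) (auto simp: add_increasing add_increasing2)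
    finally have 1: "t * qnorm X v \<le> C * s" .
    have "t * qnorm Y v \<le> t * (C * (qnorm Y a1 + qnorm Y b1))"
      unfolding v' using a b t by (intro mult_left_mono Y.qnorm_diff_le)
    also have "\<dots> = C * (t * qnorm Y a1 + t * qnorm Y b1)"
      by (simp add: algebra_simps)
    also have "\<dots> \<le> C * s"
      unfolding s_def using n t C_nonneg mult_left_le_one_le[of "qnorm Y b1" t]
      by (intro mult_left_mono) (auto simp: add_increasing add_increasing2)
    finally have 2: "t * qnorm Y v \<le> C * s" .
    have 3: "t * qnorm (inter_space X Y) v \<le> C * s"
      using 1 2 by (auto simp: inter_space_def max_def)
    have "qnorm (sum_space X Y) (a0 + b1) \<le> qnorm X a0 + 1 * qnorm Y b1"
      unfolding qnorm_sum_space using a b nonneg by (intro K_functional_le) auto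
    also have "\<dots> \<le> s" unfolding s_def using n t by simp
    also have "\<dots> \<le> C * s"
      using C_ge_1 n t mult_right_mono[of 1 C s] by (simp add: s_def)
    finally have 4: "qnorm (sum_space X Y) (a0 + b1) \<le> C * s" .
    have "x = (a0 + b1) + v" using b by (simp add: v_def algebra_simps)
    moreover have "a0 + b1 \<in> carrier (sum_space X Y)" using a b by (auto simp: mem_carrier_sum_space)
    ultimately have "K_functional x t (sum_space X Y) (inter_space X Y)
        \<le> qnorm (sum_space X Y) (a0 + b1) + t * qnorm (inter_space X Y) v"
      using K_functional_le[OF nonneg_sum nonneg_inter t(1), of "a0 + b1" v] v vY
      by (simp add: inter_space_def)
    also have "\<dots> \<le> 2 * C * s" using 3 4 by simp
    also have "\<dots> \<le> 2 * C * ((K_functional x t X Y + K_functional x t Y X) + e)"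
      unfolding s_def using a b C_nonneg by (intro mult_left_mono) auto
    finally show ?thesis .
  qed
  show ?thesis
  proof (rule field_le_epsilon)
    fix e :: real assume "e > 0"
    then show "K_functional x t (sum_space X Y) (inter_space X Y)
     \<le> 2 * C * (K_functional x t X Y + K_functional x t Y X) + e"
      using le[of "e / (2 * C)"] C_ge_1 by (simp add: distrib_left)
  qed
qed

text \<open>For x = u + v with v in the intersection, K(u, t) \<le> K(u, 1), which is the norm of u
  in the sum, and K(v, t) is at most t times the norm of v in \<open>Y\<close>. Then the infimum
  over u and v is taken.\<close>

lemma K_le_K_sum_inter:
  assumes x: "x \<in> carrier (sum_space X Y)" and t: "0 \<le> t" "t \<le> 1"
  shows "K_functional x t X Y \<le> C * K_functional x t (sum_space X Y) (inter_space X Y)"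
proof -
  have "K_functional x t X Y / C \<le> K_functional x t (sum_space X Y) (inter_space X Y)"
  proof (rule K_functional_greatest)
    fix u v
    assume u: "u \<in> carrier (sum_space X Y)" and v: "v \<in> carrier (inter_space X Y)"
      and xuv: "x = u + v"
    have v': "v \<in> carrier X" "v \<in> carrier Y" using v by (auto simp: inter_space_def)
    have "K_functional x t X Y \<le> C * (K_functional u t X Y + K_functional v t X Y)"
      unfolding xuv using u v' t carrier_subset_sum by (intro K_functional_add) auto
    also have "\<dots> \<le> C * (K_functional u 1 X Y + t * qnorm Y v)"
      using u v' t nonneg
      by (intro mult_left_mono add_mono C_nonneg K_functional_mono K_functional_le_right)
    also have "\<dots> \<le> C * (qnorm (sum_space X Y) u + t * qnorm (inter_space X Y) v)"
      unfolding qnorm_sum_space using t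
      by (intro mult_left_mono add_mono C_nonneg) (auto simp: inter_space_def)
    finally show "K_functional x t X Y / C
        \<le> qnorm (sum_space X Y) u + t * qnorm (inter_space X Y) v"
      using C_ge_1 by (simp add: field_simps)
  qed (simp add: carrier_sum_inter x)
  then show ?thesis using C_ge_1 by (simp add: field_simps)
qed

lemma K_functional_mono_on:
  assumes "x \<in> carrier (sum_space X Y)"
  shows "mono_on {0<..} (\<lambda>t. K_functional x t X Y)"
  using K_functional_mono[OF nonneg assms] by (auto simp: mono_on_def)

end

section \<open>Inequalities up to a uniform constant\<close>

text \<open>The constant is finite and uniform over the index set. The indices are elements, pairs
  of elements, or elements with a chosen decomposition, so uniformity in all of these is recorded by
  one transitive relation.\<close>

definition dominated :: "'i set \<Rightarrow> ('i \<Rightarrow> ennreal) \<Rightarrow> ('i \<Rightarrow> ennreal) \<Rightarrow> bool" where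
  "dominated A f g \<longleftrightarrow> (\<exists>D>0. \<forall>i\<in>A. f i \<le> ennreal D * g i)"

lemma dominatedI:
  assumes "\<And>i. i \<in> A \<Longrightarrow> f i \<le> ennreal D * g i"
  shows "dominated A f g"
  unfolding dominated_def
\<comment> \<open>Enlarging \<open>D\<close> ensures positivity, so users of this rule need not
  check it.\<close>
proof (intro exI[of _ "max D 1"] conjI ballI)
  fix i assume "i \<in> A"
  then have "f i \<le> ennreal D * g i" by (rule assms)
  also have "\<dots> \<le> ennreal (max D 1) * g i"
    by (intro mult_right_mono ennreal_leI) auto
  finally show "f i \<le> ennreal (max D 1) * g i" .
qed auto

lemma dominated_le: "(\<And>i. i \<in> A \<Longrightarrow> f i \<le> g i) \<Longrightarrow> dominated A f g"
  by (rule dominatedI[where D = 1]) simp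

lemma dominated_trans [trans]:
  assumes "dominated A f g" "dominated A g h"
  shows "dominated A f h"
proof -
  obtain D E where D: "D > 0" "\<And>i. i \<in> A \<Longrightarrow> f i \<le> ennreal D * g i"
    and E: "E > 0" "\<And>i. i \<in> A \<Longrightarrow> g i \<le> ennreal E * h i"
    using assms unfolding dominated_def by blast
  show ?thesis
  proof (rule dominatedI)
    fix i assume i: "i \<in> A"
    have "f i \<le> ennreal D * (ennreal E * h i)"
      using D(2)[OF i] E(2)[OF i] by (meson mult_left_mono order_trans zero_le)
    then show "f i \<le> ennreal (D * E) * h i"
      using D(1) E(1) by (simp add: ennreal_mult mult.assoc)
  qed
qed

lemma dominated_add:
  assumes "dominated A f h" "dominated A g h"
  shows "dominated A (\<lambda>i. f i + g i) h"
proof -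
  obtain D E where D: "D > 0" "\<And>i. i \<in> A \<Longrightarrow> f i \<le> ennreal D * h i"
    and E: "E > 0" "\<And>i. i \<in> A \<Longrightarrow> g i \<le> ennreal E * h i"
    using assms unfolding dominated_def by blast
  show ?thesis
  proof (rule dominatedI)
    fix i assume i: "i \<in> A"
    have "f i + g i \<le> ennreal D * h i + ennreal E * h i"
      using D(2)[OF i] E(2)[OF i] by (rule add_mono)
    then show "f i + g i \<le> ennreal (D + E) * h i"
      using D(1) E(1) by (simp add: distrib_right)
  qed
qed

lemma dominated_reindex: "dominated A f g \<Longrightarrow> (\<And>i. i \<in> B \<Longrightarrow> k i \<in> A) \<Longrightarrow> dominated B (\<lambda>i. f (k i)) (\<lambda>i. g (k i))"
  unfolding dominated_def by blast

text \<open>A pointwise bound with constant \<open>c\<close> passes to the integrals with constant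
  \<open>c powr p * 2 powr p\<close>, which is independent of the index.\<close>

lemma dominated_weighted_integral:
  assumes "\<And>i. i \<in> A \<Longrightarrow> mono_on {0<..} (g i)" "\<And>i. i \<in> A \<Longrightarrow> mono_on {0<..} (h i)"
    and "\<And>i t. i \<in> A \<Longrightarrow> t \<in> S \<Longrightarrow> 0 \<le> f i t"
    and "\<And>i t. i \<in> A \<Longrightarrow> t \<in> S \<Longrightarrow> 0 \<le> g i t"
    and "\<And>i t. i \<in> A \<Longrightarrow> t \<in> S \<Longrightarrow> 0 \<le> h i t"
    and le: "\<And>i t. i \<in> A \<Longrightarrow> t \<in> S \<Longrightarrow> f i t \<le> c * (g i t + h i t)"
    and S: "S \<in> sets borel" "S \<subseteq> {0<..}" and c: "0 \<le> c" and p: "0 \<le> p"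
  shows "dominated A (\<lambda>i. weighted_integral S a p (f i))
    (\<lambda>i. weighted_integral S a p (g i) + weighted_integral S a p (h i))"
proof (rule dominatedI)
  fix i assume i: "i \<in> A"
  have m: "mono_on {0<..} (\<lambda>t. g i t + h i t)"
    using assms(1,2)[OF i] by (auto simp: mono_on_def intro!: add_mono)
  have "weighted_integral S a p (f i) \<le> weighted_integral S a p (\<lambda>t. c * (g i t + h i t))"
    using assms i by (intro weighted_integral_mono) auto
  also have "\<dots> = ennreal (c powr p) * weighted_integral S a p (\<lambda>t. g i t + h i t)"
    using assms i m by (intro weighted_integral_cmult) auto
  also have "\<dots> \<le> ennreal (c powr p) *
      (ennreal (2 powr p) * (weighted_integral S a p (g i) + weighted_integral S a p (h i)))"
    using assms i by (intro mult_left_mono weighted_integral_add) auto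
  also have "\<dots> = ennreal (c powr p * 2 powr p) *
      (weighted_integral S a p (g i) + weighted_integral S a p (h i))"
    by (simp add: ennreal_mult mult.assoc)
  finally show "weighted_integral S a p (f i) \<le> ennreal (c powr p * 2 powr p) *
      (weighted_integral S a p (g i) + weighted_integral S a p (h i))" .
qed

lemma weighted_integral_const:
  assumes "0 < a" "0 < p" "0 \<le> c"
  shows "weighted_integral {1..} a p (\<lambda>_. c) = ennreal (c powr p) * ennreal (1 / (a * p))"
  using weighted_integral_cmult[of "\<lambda>_. 1" "{1..}" c a p] weighted_integral_one[of a p] assms
  by (auto simp: mono_on_def subset_iff)

text \<open>Inversion turns the function t on (0, 1] with exponent \<open>a\<close> into the
  constant 1 on [1, \<infinity>) with exponent \<open>1 - a\<close>.\<close>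

lemma weighted_integral_linear:
  assumes "a < 1" "0 < p" "0 \<le> c"
  shows "weighted_integral {0<..1} a p (\<lambda>t. c * t) = ennreal (c powr p) * ennreal (1 / ((1 - a) * p))"
proof -
  have "weighted_integral {0<..1} a p (\<lambda>t. t) = ennreal (1 / ((1 - a) * p))"
    using weighted_integral_inverse[of "\<lambda>_. 1" "1 - a" p] weighted_integral_one[of "1 - a" p] assms
    by (auto simp: mono_on_def)
  then show ?thesis
    using weighted_integral_cmult[of "\<lambda>t. t" "{0<..1}" c a p] assms
    by (auto simp: mono_on_def subset_iff)
qed

section \<open>The couple of the sum and the intersection\<close>

abbreviation K_near :: "'a::real_vector qn_space \<Rightarrow> 'a qn_space \<Rightarrow> real \<Rightarrow> real \<Rightarrow> 'a \<Rightarrow> ennreal" where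
  "K_near X Y a p x \<equiv> weighted_integral {0<..1} a p (\<lambda>t. K_functional x t X Y)"

abbreviation K_far :: "'a::real_vector qn_space \<Rightarrow> 'a qn_space \<Rightarrow> real \<Rightarrow> real \<Rightarrow> 'a \<Rightarrow> ennreal" where
  "K_far X Y a p x \<equiv> weighted_integral {1..} a p (\<lambda>t. K_functional x t X Y)"

lemma interp_integral_split:
  assumes "mono_on {0<..} (\<lambda>t. K_functional x t X Y)"
  shows "interp_integral X Y a p x = K_near X Y a p x + K_far X Y a p x"
  using weighted_integral_split[OF assms]
  by (simp add: interp_integral_def weighted_integral_def)

context quasi_normed_pair
begin

lemma K_nonneg: "x \<in> carrier (sum_space X Y) \<Longrightarrow> 0 \<le> t \<Longrightarrow> 0 \<le> K_functional x t X Y"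
  using K_functional_nonneg nonneg by blast

text \<open>Inversion combined with \<open>K_functional_swap\<close>. It allows everything to be
  expressed by integrals over (0, 1], for the couple and its reversal.\<close>

lemma K_far_eq_K_near:
  assumes "x \<in> carrier (sum_space X Y)"
  shows "K_far X Y (1 - a) p x = K_near Y X a p x"
  using weighted_integral_inverse[OF K_functional_mono_on[OF assms], of "1 - a" p]
    K_functional_swap[OF nonneg assms]
  by (auto intro!: weighted_integral_cong)

lemma interp_integral_eq:
  assumes "x \<in> carrier (sum_space X Y)"
  shows "interp_integral X Y a p x = K_near X Y a p x + K_far X Y a p x"
  by (rule interp_integral_split[OF K_functional_mono_on[OF assms]])

text \<open>The near and far halves exchange roles under reversal. Statements about exponent
  \<open>1 - a\<close> thus follow from those about \<open>a\<close> for the reversed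
  couple.\<close>

lemma interp_integral_swap:
  assumes "x \<in> carrier (sum_space X Y)"
  shows "interp_integral X Y (1 - a) p x = interp_integral Y X a p x"
proof -
  interpret Y: quasi_normed_pair Y X C by (rule swap)
  have x': "x \<in> carrier (sum_space Y X)" using assms by (simp add: sum_space_commute)
  show ?thesis
    using Y.K_far_eq_K_near[OF x', of "1 - a" p]
    by (simp add: interp_integral_eq[OF assms] Y.interp_integral_eq[OF x'] K_far_eq_K_near[OF assms]
        add.commute)
qed

text \<open>With k = K(x, 1), the left-hand side is k^p/(ap), while K(x, t) \<ge> t k on (0, 1]
  bounds the right-hand side below by k^p/((1-a)p). The ratio (1-a)/a of the two is the
  constant.\<close>

lemma K_one_dominated:
  assumes "0 < a" "a < 1" "0 < p"
  shows "dominated (carrier (sum_space X Y))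
    (\<lambda>x. weighted_integral {1..} a p (\<lambda>_. K_functional x 1 X Y)) (K_near X Y a p)"
proof (rule dominatedI)
  fix x assume x: "x \<in> carrier (sum_space X Y)"
  let ?k = "K_functional x 1 X Y"
  have k: "0 \<le> ?k" using K_nonneg[OF x] by simp
  have "weighted_integral {0<..1} a p (\<lambda>t. ?k * t) \<le> K_near X Y a p x"
    using assms k K_functional_scale_le[OF nonneg x]
    by (intro weighted_integral_mono) (auto simp: mult.commute)
  then have le: "ennreal (?k powr p) * ennreal (1 / ((1 - a) * p)) \<le> K_near X Y a p x"
    using weighted_integral_linear assms k by simp
  have "1 / (a * p) = (1 - a) / a * (1 / ((1 - a) * p))"
    using assms by (simp add: field_simps)
  then have "ennreal (1 / (a * p)) = ennreal ((1 - a) / a) * ennreal (1 / ((1 - a) * p))"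
    using assms by (simp add: ennreal_mult[symmetric])
  then have "weighted_integral {1..} a p (\<lambda>_. ?k)
      = ennreal ((1 - a) / a) * (ennreal (?k powr p) * ennreal (1 / ((1 - a) * p)))"
    using weighted_integral_const[of a p ?k] assms k by (simp add: mult_ac)
  also have "\<dots> \<le> ennreal ((1 - a) / a) * K_near X Y a p x"
    by (intro mult_left_mono le) auto
  finally show "weighted_integral {1..} a p (\<lambda>_. ?k) \<le> ennreal ((1 - a) / a) * K_near X Y a p x" .
qed

lemma K_sum_inter_mono_on:
  assumes "x \<in> carrier (sum_space X Y)"
  shows "mono_on {0<..} (\<lambda>t. K_functional x t (sum_space X Y) (inter_space X Y))"
  using K_functional_mono[OF nonneg_sum nonneg_inter] assms carrier_sum_inter
  by (auto simp: mono_on_def)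

lemma K_sum_inter_nonneg:
  assumes "x \<in> carrier (sum_space X Y)" "0 \<le> t"
  shows "0 \<le> K_functional x t (sum_space X Y) (inter_space X Y)"
  using K_functional_nonneg[OF nonneg_sum nonneg_inter] assms carrier_sum_inter by auto

lemma interp_sum_inter_eq:
  assumes "x \<in> carrier (sum_space X Y)"
  shows "interp_integral (sum_space X Y) (inter_space X Y) a p x =
    K_near (sum_space X Y) (inter_space X Y) a p x + K_far (sum_space X Y) (inter_space X Y) a p x"
  by (rule interp_integral_split[OF K_sum_inter_mono_on[OF assms]])

text \<open>On (0, 1] the pointwise bound \<open>K_sum_inter_le\<close> applies. On [1, \<infinity>)
  the integrand is bounded through the constant K(x, 1), whose integral
  \<open>K_one_dominated\<close> absorbs into the near part.\<close>

lemma interp_sum_inter_dominated: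
  assumes "0 < a" "a < 1" "0 < p"
  shows "dominated (carrier (sum_space X Y)) (interp_integral (sum_space X Y) (inter_space X Y) a p)
    (\<lambda>x. K_near X Y a p x + K_near Y X a p x)"
proof -
  let ?S = "carrier (sum_space X Y)"
  interpret Y: quasi_normed_pair Y X C by (rule swap)
  have S': "carrier (sum_space Y X) = ?S" by (simp add: sum_space_commute)
  have "dominated ?S (interp_integral (sum_space X Y) (inter_space X Y) a p)
    (\<lambda>x. K_near (sum_space X Y) (inter_space X Y) a p x + K_far (sum_space X Y) (inter_space X Y) a p x)"
    by (rule dominated_le) (simp add: interp_sum_inter_eq)
  also have "dominated ?S \<dots> (\<lambda>x. K_near X Y a p x + K_near Y X a p x)"
  proof (rule dominated_add)
    show "dominated ?S (K_near (sum_space X Y) (inter_space X Y) a p)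
      (\<lambda>x. K_near X Y a p x + K_near Y X a p x)"
      by (rule dominated_weighted_integral[where c = "2 * C"])
        (use C_nonneg assms K_functional_mono_on Y.K_functional_mono_on S' K_sum_inter_nonneg
          K_nonneg Y.K_nonneg K_sum_inter_le in auto)
    have "dominated ?S (K_far (sum_space X Y) (inter_space X Y) a p)
        (\<lambda>x. weighted_integral {1..} a p (\<lambda>_. K_functional x 1 X Y))"
      using assms by (intro dominated_le weighted_integral_mono K_sum_inter_nonneg K_sum_inter_le_one) auto
    also have "dominated ?S \<dots> (K_near X Y a p)"
      by (rule K_one_dominated[OF assms])
    also have "dominated ?S \<dots> (\<lambda>x. K_near X Y a p x + K_near Y X a p x)"
      by (rule dominated_le) simp
    finally show "dominated ?S (K_far (sum_space X Y) (inter_space X Y) a p)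
      (\<lambda>x. K_near X Y a p x + K_near Y X a p x)" .
  qed
  finally show ?thesis .
qed

lemma K_near_dominated:
  assumes "0 \<le> p"
  shows "dominated (carrier (sum_space X Y)) (K_near X Y a p)
    (interp_integral (sum_space X Y) (inter_space X Y) a p)"
proof (rule dominatedI)
  fix x assume x: "x \<in> carrier (sum_space X Y)"
  have "K_near X Y a p x
      \<le> weighted_integral {0<..1} a p (\<lambda>t. C * K_functional x t (sum_space X Y) (inter_space X Y))"
    using assms x K_nonneg K_le_K_sum_inter by (intro weighted_integral_mono) auto
  also have "\<dots> = ennreal (C powr p) * K_near (sum_space X Y) (inter_space X Y) a p x"
    using C_nonneg x K_sum_inter_mono_on K_sum_inter_nonneg
    by (intro weighted_integral_cmult) auto
  also have "\<dots> \<le> ennreal (C powr p) * interp_integral (sum_space X Y) (inter_space X Y) a p x"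
    by (intro mult_left_mono) (auto simp: interp_sum_inter_eq[OF x])
  finally show "K_near X Y a p x
      \<le> ennreal (C powr p) * interp_integral (sum_space X Y) (inter_space X Y) a p x" .
qed

text \<open>The sum and the intersection are symmetric in the two spaces, so
  \<open>K_near_dominated\<close> applies to both orders with the same right-hand side.\<close>

lemma K_near_sum_dominated:
  assumes "0 \<le> p"
  shows "dominated (carrier (sum_space X Y)) (\<lambda>x. K_near X Y a p x + K_near Y X a p x)
    (interp_integral (sum_space X Y) (inter_space X Y) a p)"
proof -
  interpret Y: quasi_normed_pair Y X C by (rule swap)
  show ?thesis
    using K_near_dominated[OF assms] Y.K_near_dominated[OF assms]
    unfolding sum_space_commute[of Y X] inter_space_commute[of Y X] by (rule dominated_add)
qed

text \<open>For t \<ge> 1 and a \<ge> 1/2 one has t^(-a) \<le> t^(-(1-a)); the far half with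
  exponent \<open>1 - a\<close> is the near half of the reversed couple.\<close>

lemma interp_integral_le_near:
  assumes "1 / 2 \<le> a" "0 \<le> p" "x \<in> carrier (sum_space X Y)"
  shows "interp_integral X Y a p x \<le> K_near X Y a p x + K_near Y X a p x"
proof -
  have "K_far X Y a p x \<le> K_far X Y (1 - a) p x"
    using assms K_nonneg by (intro weighted_integral_mono_weight powr_mono) auto
  then show ?thesis
    by (simp add: interp_integral_eq[OF assms(3)] K_far_eq_K_near[OF assms(3)])
qed

text \<open>The same comparison of weights on [1, \<infinity>), reversed because a \<le>
  1/2.\<close>

lemma near_le_interp_integral:
  assumes "a \<le> 1 / 2" "0 \<le> p" "x \<in> carrier (sum_space X Y)"
  shows "K_near X Y a p x + K_near Y X a p x \<le> interp_integral X Y a p x"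
proof -
  have "K_far X Y (1 - a) p x \<le> K_far X Y a p x"
    using assms K_nonneg by (intro weighted_integral_mono_weight powr_mono) auto
  then show ?thesis
    by (simp add: interp_integral_eq[OF assms(3)] K_far_eq_K_near[OF assms(3)])
qed

lemma K_near_add_dominated:
  assumes "0 \<le> p"
  shows "dominated (carrier (sum_space X Y) \<times> carrier (sum_space X Y))
    (\<lambda>(x, y). K_near X Y a p (x + y)) (\<lambda>(x, y). K_near X Y a p x + K_near X Y a p y)"
proof -
  have "x + y \<in> carrier (sum_space X Y)"
    if "x \<in> carrier (sum_space X Y)" "y \<in> carrier (sum_space X Y)" for x y
    using sum_subspace that by (rule subspace_add)
  then have "dominated (carrier (sum_space X Y) \<times> carrier (sum_space X Y))
    (\<lambda>i. weighted_integral {0<..1} a p (\<lambda>t. K_functional (fst i + snd i) t X Y))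
    (\<lambda>i. weighted_integral {0<..1} a p (\<lambda>t. K_functional (fst i) t X Y)
      + weighted_integral {0<..1} a p (\<lambda>t. K_functional (snd i) t X Y))"
    by (intro dominated_weighted_integral[where c = C])
      (use C_nonneg assms K_functional_mono_on K_nonneg K_functional_add in auto)
  then show ?thesis by (simp add: case_prod_unfold)
qed

section \<open>Nearly optimal decompositions at t = 1\<close>

text \<open>The infimum need not be attained, hence the error \<open>e\<close>. As a component of
  the index it is covered by the uniformity of \<open>dominated\<close>, so \<open>e\<close> can
  tend to 0 afterwards.\<close>

definition near_optimal :: "('a \<times> real \<times> 'a \<times> 'a) set" where
  "near_optimal = {(x, e, a, b). 0 < e \<and> a \<in> carrier X \<and> b \<in> carrier Y \<and> x = a + b \<and>
     qnorm X a + qnorm Y b \<le> K_functional x 1 X Y + e}"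

lemma near_optimalD:
  assumes "(x, e, a, b) \<in> near_optimal"
  shows "0 < e" "a \<in> carrier X" "b \<in> carrier Y" "x = a + b" "x \<in> carrier (sum_space X Y)"
    "a \<in> carrier (sum_space X Y)" "b \<in> carrier (sum_space X Y)"
    "qnorm X a \<le> K_functional x 1 X Y + e" "qnorm Y b \<le> K_functional x 1 X Y + e"
proof -
  interpret Y: quasi_normed_pair Y X C by (rule swap)
  show "0 < e" "a \<in> carrier X" "b \<in> carrier Y" "x = a + b" "x \<in> carrier (sum_space X Y)"
    "a \<in> carrier (sum_space X Y)" "b \<in> carrier (sum_space X Y)"
    using assms carrier_subset_sum Y.carrier_subset_sum
    by (auto simp: near_optimal_def mem_carrier_sum_space[of "a + b"] sum_space_commute[of Y X])
  then have "0 \<le> qnorm X a" "0 \<le> qnorm Y b"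
    using nonneg by (auto simp: qnorm_nonneg_def)
  then show "qnorm X a \<le> K_functional x 1 X Y + e" "qnorm Y b \<le> K_functional x 1 X Y + e"
    using assms by (auto simp: near_optimal_def)
qed

text \<open>
  Subtracting the other summand shows that \<open>K(a, t)\<close> is controlled by \<open>K(x, t) + t e\<close> for
  \<open>t \<le> 1\<close>; for \<open>t \<ge> 1\<close> the trivial bound by the norm of \<open>a\<close> suffices.
\<close>

lemma interp_integral_near_optimal:
  assumes s: "0 < s" "s < 1" "0 < p"
  shows "dominated near_optimal (\<lambda>(x, e, a, b). interp_integral X Y s p a)
    (\<lambda>(x, e, a, b). K_near X Y s p x + ennreal (e powr p))"
proof -
  interpret Y: quasi_normed_pair Y X C by (rule swap)
  let ?R = "\<lambda>(x, e, a, b). K_near X Y s p x + ennreal (e powr p)"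
  have near: "dominated near_optimal (\<lambda>i. weighted_integral {0<..1} s p ((\<lambda>(x, e, a, b) t. K_functional a t X Y) i))
    (\<lambda>i. weighted_integral {0<..1} s p ((\<lambda>(x, e, a, b) t. K_functional x t X Y) i)
      + weighted_integral {0<..1} s p ((\<lambda>(x, e, a, b) t. e * t) i))"
  proof (rule dominated_weighted_integral[where c = "2 * C"]; clarsimp?)
    fix x e a b and t :: real
    assume i: "(x, e, a, b) \<in> near_optimal" and t: "0 < t" "t \<le> 1"
    note i = near_optimalD[OF i]
    show et: "0 \<le> e * t" using i(1) t(1) by simp
    have mb: "- b \<in> carrier Y" using i subspaces by (auto intro: subspace_neg)
    then have mb': "- b \<in> carrier (sum_space X Y)"
      using Y.carrier_subset_sum by (auto simp: sum_space_commute)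
    have "K_functional (- b) t X Y \<le> t * qnorm Y (- b)"
      using mb t by (intro K_functional_le_right) auto
    also have "\<dots> \<le> t * (K_functional x 1 X Y + e)"
      using i t by (subst Y.qnorm_minus) (auto intro!: mult_left_mono)
    \<comment> \<open>This is t K(x, 1) \<le> K(x, t), valid since t \<le> 1.\<close>
    also have "\<dots> \<le> K_functional x t X Y + e * t"
      using K_functional_scale_le[OF nonneg i(5), of t] t by (simp add: algebra_simps)
    finally have mb_le: "K_functional (- b) t X Y \<le> K_functional x t X Y + e * t" .
    have "K_functional a t X Y = K_functional (x + - b) t X Y"
      using i by simp
    also have "\<dots> \<le> C * (K_functional x t X Y + K_functional (- b) t X Y)"
      using i mb' t by (intro K_functional_add) auto
    also have "\<dots> \<le> C * (2 * (K_functional x t X Y + e * t))"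
      using mb_le et by (intro mult_left_mono C_nonneg) (linarith | simp)+
    finally show "K_functional a t X Y \<le> 2 * C * (K_functional x t X Y + e * t)"
      by (simp add: mult_ac)
  qed (use s near_optimalD K_functional_mono_on K_nonneg C_nonneg in
    \<open>auto simp: mono_on_def dest: less_imp_le\<close>)
  \<comment> \<open>The linear error \<open>e * t\<close> is integrable against the weight on (0, 1]
    because \<open>s < 1\<close>, and contributes a multiple of \<open>e powr p\<close>.\<close>
  also have "dominated near_optimal \<dots> ?R"
  proof (rule dominated_add)
    show "dominated near_optimal
      (\<lambda>i. weighted_integral {0<..1} s p ((\<lambda>(x, e, a, b) t. K_functional x t X Y) i)) ?R"
      by (rule dominated_le) auto
    show "dominated near_optimal
      (\<lambda>i. weighted_integral {0<..1} s p ((\<lambda>(x, e, a, b) t. e * t) i)) ?R"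
    proof (rule dominatedI)
      fix i assume "i \<in> near_optimal"
      then obtain x e a b where i: "i = (x, e, a, b)" "0 < e"
        using near_optimalD(1) by (cases i) auto
      have "weighted_integral {0<..1} s p (\<lambda>t. e * t) = ennreal (1 / ((1 - s) * p)) * ennreal (e powr p)"
        using weighted_integral_linear[of s p e] s i(2) by (simp add: mult.commute)
      also have "\<dots> \<le> ennreal (1 / ((1 - s) * p)) * (K_near X Y s p x + ennreal (e powr p))"
        by (intro mult_left_mono) auto
      finally show "weighted_integral {0<..1} s p ((\<lambda>(x, e, a, b) t. e * t) i)
          \<le> ennreal (1 / ((1 - s) * p)) * ?R i"
        using i(1) by simp
    qed
  qed
  finally have near: "dominated near_optimal
    (\<lambda>i. weighted_integral {0<..1} s p ((\<lambda>(x, e, a, b) t. K_functional a t X Y) i)) ?R" .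
  have far: "dominated near_optimal (\<lambda>i. weighted_integral {1..} s p ((\<lambda>(x, e, a, b) t. K_functional a t X Y) i))
    (\<lambda>i. weighted_integral {1..} s p ((\<lambda>(x, e, a, b) t. K_functional x 1 X Y) i)
      + weighted_integral {1..} s p ((\<lambda>(x, e, a, b) t. e) i))"
  proof (rule dominated_weighted_integral[where c = 1]; clarsimp?)
    fix x e a b and t :: real
    assume i: "(x, e, a, b) \<in> near_optimal" and t: "1 \<le> t"
    show "0 \<le> e" using near_optimalD(1)[OF i] by simp
    show "K_functional a t X Y \<le> K_functional x 1 X Y + e"
      using K_functional_le_left[of a t] near_optimalD[OF i] t by linarith
  qed (use s near_optimalD K_nonneg in \<open>auto simp: mono_on_def dest: less_imp_le\<close>)
  \<comment> \<open>The constant K(x, 1) is absorbed by the near part of \<open>x\<close>; the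
    constant \<open>e\<close> contributes a multiple of \<open>e powr p\<close> because
    \<open>s > 0\<close>.\<close>
  also have "dominated near_optimal \<dots> ?R"
  proof (rule dominated_add)
    have "dominated near_optimal
      (\<lambda>i. weighted_integral {1..} s p ((\<lambda>(x, e, a, b) t. K_functional x 1 X Y) i))
      (\<lambda>i. K_near X Y s p (fst i))"
      using dominated_reindex[OF K_one_dominated[OF s], of near_optimal fst] near_optimalD(5)
      by (auto simp: case_prod_unfold)
    also have "dominated near_optimal \<dots> ?R"
      by (rule dominated_le) auto
    finally show "dominated near_optimal
      (\<lambda>i. weighted_integral {1..} s p ((\<lambda>(x, e, a, b) t. K_functional x 1 X Y) i)) ?R" .
    show "dominated near_optimal
      (\<lambda>i. weighted_integral {1..} s p ((\<lambda>(x, e, a, b) t. e) i)) ?R"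
    proof (rule dominatedI)
      fix i assume "i \<in> near_optimal"
      then obtain x e a b where i: "i = (x, e, a, b)" "0 < e"
        using near_optimalD(1) by (cases i) auto
      have "weighted_integral {1..} s p (\<lambda>t. e) = ennreal (1 / (s * p)) * ennreal (e powr p)"
        using weighted_integral_const[of s p e] s i(2) by (simp add: mult.commute)
      also have "\<dots> \<le> ennreal (1 / (s * p)) * (K_near X Y s p x + ennreal (e powr p))"
        by (intro mult_left_mono) auto
      finally show "weighted_integral {1..} s p ((\<lambda>(x, e, a, b) t. e) i)
          \<le> ennreal (1 / (s * p)) * ?R i"
        using i(1) by simp
    qed
  qed
  finally have far: "dominated near_optimal
    (\<lambda>i. weighted_integral {1..} s p ((\<lambda>(x, e, a, b) t. K_functional a t X Y) i)) ?R" .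
  have "dominated near_optimal (\<lambda>(x, e, a, b). interp_integral X Y s p a)
    (\<lambda>i. weighted_integral {0<..1} s p ((\<lambda>(x, e, a, b) t. K_functional a t X Y) i)
      + weighted_integral {1..} s p ((\<lambda>(x, e, a, b) t. K_functional a t X Y) i))"
    by (rule dominated_le) (auto simp: interp_integral_eq near_optimalD)
  also have "dominated near_optimal \<dots> ?R"
    using near far by (rule dominated_add)
  finally show ?thesis .
qed

end

section \<open>Equivalence of the interpolation spaces\<close>

text \<open>Passage from \<open>p\<close>-th powers to quasi-norms: \<open>powr_add_le\<close> with
  exponent 1/p produces the factor 2^(1/p). Finiteness of \<open>g\<close> and \<open>h\<close>
  matters, as \<open>enn2real\<close> sends \<infinity> to 0.\<close>

lemma enn2real_powr_le:
  assumes "f \<le> ennreal D * (g + h)" "g < \<infinity>" "h < \<infinity>" "0 \<le> D" "0 < p"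
  shows "enn2real f powr (1 / p)
    \<le> (2 * D) powr (1 / p) * (enn2real g powr (1 / p) + enn2real h powr (1 / p))"
proof -
  have "enn2real f \<le> enn2real (ennreal D * (g + h))"
    using assms by (intro enn2real_mono) (auto simp: ennreal_mult_less_top)
  also have "\<dots> = D * (enn2real g + enn2real h)"
    using assms by (simp add: enn2real_mult enn2real_plus)
  finally have "enn2real f powr (1 / p) \<le> (D * (enn2real g + enn2real h)) powr (1 / p)"
    using assms by (intro powr_mono2) auto
  also have "\<dots> = D powr (1 / p) * (enn2real g + enn2real h) powr (1 / p)"
    using assms by (simp add: powr_mult)
  also have "\<dots> \<le> D powr (1 / p) *
      (2 powr (1 / p) * (enn2real g powr (1 / p) + enn2real h powr (1 / p)))"
    using assms by (intro mult_left_mono powr_add_le) auto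
  finally show ?thesis using assms by (simp add: powr_mult mult_ac)
qed

lemma enn2real_powr_le':
  assumes "f \<le> ennreal D * g" "g < \<infinity>" "0 \<le> D" "0 < p"
  shows "enn2real f powr (1 / p) \<le> (2 * D) powr (1 / p) * enn2real g powr (1 / p)"
  using enn2real_powr_le[of f D g 0 p] assms by simp

lemma ennreal_bound_less_top: "f \<le> ennreal D * g \<Longrightarrow> g < \<infinity> \<Longrightarrow> f < (\<infinity>::ennreal)"
  by (rule le_less_trans[of f "ennreal D * g"]) (auto simp: ennreal_mult_less_top)

lemma mem_carrier_interp_space:
  "x \<in> carrier (interp_space X Y a p) \<longleftrightarrow>
    x \<in> carrier (sum_space X Y) \<and> interp_integral X Y a p x < \<infinity>"
  by (simp add: interp_space_def)

lemma qnorm_interp_space: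
  "qnorm (interp_space X Y a p) x = enn2real (interp_integral X Y a p x) powr (1 / p)"
  by (simp add: interp_space_def)

lemma qnorm_nonneg_interp_space: "qnorm_nonneg (interp_space X Y a p)"
  by (simp add: qnorm_nonneg_def qnorm_interp_space)

context quasi_normed_pair
begin

section \<open>The intersection, for exponents at least 1/2\<close>

text \<open>Let G be the sum of the near parts of the couple and its reversal. The integral
  \<open>I\<close> is equivalent to G. Both near parts occur in \<open>J0 + J1\<close>, and
  conversely \<open>J0\<close> and \<open>J1\<close> are each at most G.\<close>

lemma interp_sum_inter_equiv_inter:
  assumes s: "1 / 2 \<le> s" "s < 1" and p: "0 < p"
  shows "equal_equiv (interp_space (sum_space X Y) (inter_space X Y) s p)
    (inter_space (interp_space X Y s p) (interp_space X Y (1 - s) p))"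
proof -
  interpret Y: quasi_normed_pair Y X C by (rule swap)
  have s0: "0 < s" using s by simp
  let ?S = "carrier (sum_space X Y)"
  define I where "I = interp_integral (sum_space X Y) (inter_space X Y) s p"
  define J0 where "J0 = interp_integral X Y s p"
  define J1 where "J1 = interp_integral X Y (1 - s) p"
  have J1: "J1 x = interp_integral Y X s p x" if "x \<in> ?S" for x
    using that by (simp add: J1_def interp_integral_swap)
  have S': "carrier (sum_space Y X) = ?S" by (simp add: sum_space_commute)
  have le: "K_near X Y s p x + K_near Y X s p x \<le> J0 x + J1 x" if "x \<in> ?S" for x
    using that S' by (auto simp: J1 J0_def interp_integral_eq Y.interp_integral_eq intro!: add_mono)
  have "dominated ?S I (\<lambda>x. K_near X Y s p x + K_near Y X s p x)"
    unfolding I_def using s0 s(2) p by (rule interp_sum_inter_dominated)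
  also have "dominated ?S \<dots> (\<lambda>x. J0 x + J1 x)" using le by (rule dominated_le)
  finally have "dominated ?S I (\<lambda>x. J0 x + J1 x)" .
  then obtain D where D: "D > 0" "\<And>x. x \<in> ?S \<Longrightarrow> I x \<le> ennreal D * (J0 x + J1 x)"
    unfolding dominated_def by blast
  have near: "dominated ?S (\<lambda>x. K_near X Y s p x + K_near Y X s p x) I"
    unfolding I_def using p by (intro K_near_sum_dominated) auto
  \<comment> \<open>Here, and in the same bound for \<open>J1\<close>, the hypothesis 1/2 \<le> s
    enters.\<close>
  have "dominated ?S J0 (\<lambda>x. K_near X Y s p x + K_near Y X s p x)"
    unfolding J0_def using s p by (intro dominated_le interp_integral_le_near) auto
  from dominated_trans[OF this near]
  obtain D0 where D0: "D0 > 0" "\<And>x. x \<in> ?S \<Longrightarrow> J0 x \<le> ennreal D0 * I x"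
    unfolding dominated_def by blast
  have "dominated ?S J1 (\<lambda>x. K_near X Y s p x + K_near Y X s p x)"
    using Y.interp_integral_le_near[of s p] s p S'
    by (intro dominated_le) (auto simp: J1 add.commute)
  from dominated_trans[OF this near]
  obtain D1 where D1: "D1 > 0" "\<And>x. x \<in> ?S \<Longrightarrow> J1 x \<le> ennreal D1 * I x"
    unfolding dominated_def by blast
  have qI: "qnorm (interp_space (sum_space X Y) (inter_space X Y) s p) x = enn2real (I x) powr (1 / p)" for x
    by (simp add: qnorm_interp_space I_def)
  have qJ: "qnorm (inter_space (interp_space X Y s p) (interp_space X Y (1 - s) p)) x =
      max (enn2real (J0 x) powr (1 / p)) (enn2real (J1 x) powr (1 / p))" for x
    by (simp add: qnorm_interp_space J0_def J1_def inter_space_def)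
  have cI: "x \<in> carrier (interp_space (sum_space X Y) (inter_space X Y) s p) \<longleftrightarrow> x \<in> ?S \<and> I x < \<infinity>" for x
    by (simp add: mem_carrier_interp_space I_def carrier_sum_inter)
  have cJ: "x \<in> carrier (inter_space (interp_space X Y s p) (interp_space X Y (1 - s) p)) \<longleftrightarrow>
      x \<in> ?S \<and> J0 x < \<infinity> \<and> J1 x < \<infinity>" for x
    by (auto simp: mem_carrier_interp_space J0_def J1_def inter_space_def)
  have fin: "J0 x < \<infinity>" "J1 x < \<infinity>" if "x \<in> ?S" "I x < \<infinity>" for x
    using that D0(2) D1(2) ennreal_bound_less_top by blast+
  have fin': "I x < \<infinity>" if "x \<in> ?S" "J0 x < \<infinity>" "J1 x < \<infinity>" for x
    using ennreal_bound_less_top[OF D(2)[OF that(1)]] that by simp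
  \<comment> \<open>The maximum serves both components of the intersection norm; the leading 2 in
    \<open>c'\<close> comes from bounding a sum of two terms by twice their maximum.\<close>
  define c where "c = (2 * max D0 D1) powr (1 / p)"
  define c' where "c' = 2 * (2 * D) powr (1 / p)"
  have pos: "c > 0" "c' > 0" using D(1) D0(1) by (auto simp: c_def c'_def)
  show ?thesis
    unfolding equal_equiv_def
  proof (intro conjI exI ballI)
    show "carrier (interp_space (sum_space X Y) (inter_space X Y) s p) =
        carrier (inter_space (interp_space X Y s p) (interp_space X Y (1 - s) p))"
      using cI cJ fin fin' by blast
    show "0 < 1 / c" "0 < c'" using pos by auto
    fix x assume "x \<in> carrier (interp_space (sum_space X Y) (inter_space X Y) s p)"
    then have x: "x \<in> ?S" "I x < \<infinity>" using cI by auto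
    have "enn2real (J0 x) powr (1 / p) \<le> (2 * D0) powr (1 / p) * enn2real (I x) powr (1 / p)"
      using D0(2)[OF x(1)] x D0(1) p by (intro enn2real_powr_le') auto
    also have "\<dots> \<le> c * enn2real (I x) powr (1 / p)"
      unfolding c_def using p D0(1) by (intro mult_right_mono powr_mono2) auto
    finally have 0: "enn2real (J0 x) powr (1 / p) \<le> c * enn2real (I x) powr (1 / p)" .
    have "enn2real (J1 x) powr (1 / p) \<le> (2 * D1) powr (1 / p) * enn2real (I x) powr (1 / p)"
      using D1(2)[OF x(1)] x D1(1) p by (intro enn2real_powr_le') auto
    also have "\<dots> \<le> c * enn2real (I x) powr (1 / p)"
      unfolding c_def using p D1(1) by (intro mult_right_mono powr_mono2) auto
    finally have 1: "enn2real (J1 x) powr (1 / p) \<le> c * enn2real (I x) powr (1 / p)" .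
    show "1 / c * qnorm (inter_space (interp_space X Y s p) (interp_space X Y (1 - s) p)) x
        \<le> qnorm (interp_space (sum_space X Y) (inter_space X Y) s p) x"
      unfolding qI qJ using 0 1 pos by (simp add: field_simps)
    have "enn2real (I x) powr (1 / p)
        \<le> (2 * D) powr (1 / p) * (enn2real (J0 x) powr (1 / p) + enn2real (J1 x) powr (1 / p))"
      using D(2)[OF x(1)] fin[OF x] D(1) p by (intro enn2real_powr_le) auto
    also have "\<dots> \<le> (2 * D) powr (1 / p) *
        (2 * max (enn2real (J0 x) powr (1 / p)) (enn2real (J1 x) powr (1 / p)))"
      by (intro mult_left_mono) auto
    finally show "qnorm (interp_space (sum_space X Y) (inter_space X Y) s p) x
        \<le> c' * qnorm (inter_space (interp_space X Y s p) (interp_space X Y (1 - s) p)) x"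
      unfolding qI qJ c'_def by (simp add: mult_ac)
  qed
qed

section \<open>The sum, for exponents at most 1/2\<close>

lemma swap_near_optimal:
  assumes "(x, e, a, b) \<in> near_optimal"
  shows "(x, e, b, a) \<in> quasi_normed_pair.near_optimal Y X"
proof -
  interpret Y: quasi_normed_pair Y X C by (rule swap)
  have "K_functional x 1 Y X = K_functional x 1 X Y"
    using sum_space_commute[of X Y] by (metis qnorm_sum_space)
  then show ?thesis
    using assms by (auto simp: near_optimal_def Y.near_optimal_def add.commute)
qed

text \<open>For arbitrary y and z, \<open>I (y + z)\<close> is dominated by G(y) + G(z), with G
  written \<open>?G\<close>, and so by \<open>J0 y + J1 z\<close>. Conversely, a nearly optimal x =
  a + b has \<open>J0 a\<close> and \<open>J1 b\<close> dominated by \<open>I x + e powr p\<close>,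
  uniformly in \<open>e\<close>.\<close>

lemma interp_sum_inter_equiv_sum:
  assumes s: "0 < s" "s \<le> 1 / 2" and p: "0 < p"
  shows "equal_equiv (interp_space (sum_space X Y) (inter_space X Y) s p)
    (sum_space (interp_space X Y s p) (interp_space X Y (1 - s) p))"
proof -
  interpret Y: quasi_normed_pair Y X C by (rule swap)
  have s1: "s < 1" using s by simp
  let ?S = "carrier (sum_space X Y)"
  let ?G = "\<lambda>x. K_near X Y s p x + K_near Y X s p x"
  define I where "I = interp_integral (sum_space X Y) (inter_space X Y) s p"
  define J0 where "J0 = interp_integral X Y s p"
  define J1 where "J1 = interp_integral X Y (1 - s) p"
  have J1: "J1 x = interp_integral Y X s p x" if "x \<in> ?S" for x
    using that by (simp add: J1_def interp_integral_swap)
  have S': "carrier (sum_space Y X) = ?S" by (simp add: sum_space_commute)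
  have S_add: "x + y \<in> ?S" if "x \<in> ?S" "y \<in> ?S" for x y
    using sum_subspace that by (rule subspace_add)
  have G_J0: "?G x \<le> J0 x" if "x \<in> ?S" for x
    unfolding J0_def using s p that by (intro near_le_interp_integral) auto
  have G_J1: "?G x \<le> J1 x" if "x \<in> ?S" for x
    using Y.near_le_interp_integral[of s p x] s p that S' by (simp add: J1 add.commute)
  have near: "dominated ?S ?G I"
    unfolding I_def using p by (intro K_near_sum_dominated) auto
  have "dominated (?S \<times> ?S) (\<lambda>(y, z). I (y + z)) (\<lambda>(y, z). ?G (y + z))"
    using dominated_reindex[OF interp_sum_inter_dominated[OF s(1) s1 p], of "?S \<times> ?S" "\<lambda>(y, z). y + z"]
      S_add by (auto simp: I_def case_prod_unfold)
  also have "dominated (?S \<times> ?S) \<dots> (\<lambda>(y, z). ?G y + ?G z)"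
  proof -
    have "dominated (?S \<times> ?S) (\<lambda>(y, z). K_near X Y s p (y + z)) (\<lambda>(y, z). ?G y + ?G z)"
      using p by (rule dominated_trans[OF K_near_add_dominated[OF less_imp_le]])
        (auto intro!: dominated_le add_mono)
    moreover have "dominated (?S \<times> ?S) (\<lambda>(y, z). K_near Y X s p (y + z)) (\<lambda>(y, z). ?G y + ?G z)"
      using p by (rule dominated_trans[OF Y.K_near_add_dominated[OF less_imp_le, unfolded S']])
        (auto intro!: dominated_le add_mono)
    ultimately show ?thesis
      unfolding case_prod_unfold by (rule dominated_add)
  qed
  \<comment> \<open>The hypothesis s \<le> 1/2 enters through \<open>G_J0\<close> and
    \<open>G_J1\<close>: G is below each of \<open>J0\<close> and \<open>J1\<close>, whichever space
    the summand lies in.\<close>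
  also have "dominated (?S \<times> ?S) \<dots> (\<lambda>(y, z). J0 y + J1 z)"
    by (intro dominated_le) (auto intro!: add_mono G_J0 G_J1)
  finally obtain D where D: "D > 0"
    "\<And>y z. y \<in> ?S \<Longrightarrow> z \<in> ?S \<Longrightarrow> I (y + z) \<le> ennreal D * (J0 y + J1 z)"
    unfolding dominated_def by auto
  have R: "dominated near_optimal (\<lambda>(x, e, a, b). ?G x + ennreal (e powr p))
      (\<lambda>(x, e, a, b). I x + ennreal (e powr p))"
  proof -
    have "dominated near_optimal (\<lambda>i. ?G (fst i)) (\<lambda>i. I (fst i))"
      by (rule dominated_reindex[OF near]) (auto dest: near_optimalD(5))
    also have "dominated near_optimal \<dots> (\<lambda>(x, e, a, b). I x + ennreal (e powr p))"
      by (rule dominated_le) auto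
    finally have "dominated near_optimal (\<lambda>i. ?G (fst i)) (\<lambda>(x, e, a, b). I x + ennreal (e powr p))" .
    moreover have "dominated near_optimal (\<lambda>i. ennreal (fst (snd i) powr p))
        (\<lambda>(x, e, a, b). I x + ennreal (e powr p))"
      by (rule dominated_le) auto
    ultimately show ?thesis
      unfolding case_prod_unfold by (rule dominated_add)
  qed
  have "dominated near_optimal (\<lambda>(x, e, a, b). J0 a) (\<lambda>(x, e, a, b). K_near X Y s p x + ennreal (e powr p))"
    unfolding J0_def using s(1) s1 p by (rule interp_integral_near_optimal)
  also have "dominated near_optimal \<dots> (\<lambda>(x, e, a, b). ?G x + ennreal (e powr p))"
    by (rule dominated_le) (auto intro!: add_mono)
  also note R
  finally obtain D0 where "D0 > 0"
    "\<forall>i\<in>near_optimal. (\<lambda>(x, e, a, b). J0 a) i \<le> ennreal D0 * (\<lambda>(x, e, a, b). I x + ennreal (e powr p)) i"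
    unfolding dominated_def by blast
  then have D0: "D0 > 0" "\<And>x e a b. (x, e, a, b) \<in> near_optimal \<Longrightarrow>
      J0 a \<le> ennreal D0 * (I x + ennreal (e powr p))"
    by fastforce+
  \<comment> \<open>In the reversed couple \<open>b\<close> is the first summand, so the estimate
    for \<open>a\<close> applies to it after exchanging the last two components of the
    index.\<close>
  have "dominated near_optimal (\<lambda>(x, e, a, b). J1 b) (\<lambda>(x, e, a, b). K_near Y X s p x + ennreal (e powr p))"
  proof -
    have "dominated near_optimal (\<lambda>(x, e, a, b). J1 b) (\<lambda>(x, e, a, b). interp_integral Y X s p b)"
      by (rule dominated_le) (auto simp: J1 near_optimalD)
    also have "dominated near_optimal \<dots> (\<lambda>(x, e, a, b). K_near Y X s p x + ennreal (e powr p))"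
      using dominated_reindex[OF Y.interp_integral_near_optimal[OF s(1) s1 p], of near_optimal
          "\<lambda>(x, e, a, b). (x, e, b, a)"] swap_near_optimal
      by (auto simp: case_prod_unfold)
    finally show ?thesis .
  qed
  also have "dominated near_optimal \<dots> (\<lambda>(x, e, a, b). ?G x + ennreal (e powr p))"
    by (rule dominated_le) (auto intro!: add_mono)
  also note R
  finally obtain D1 where "D1 > 0"
    "\<forall>i\<in>near_optimal. (\<lambda>(x, e, a, b). J1 b) i \<le> ennreal D1 * (\<lambda>(x, e, a, b). I x + ennreal (e powr p)) i"
    unfolding dominated_def by blast
  then have D1: "D1 > 0" "\<And>x e a b. (x, e, a, b) \<in> near_optimal \<Longrightarrow>
      J1 b \<le> ennreal D1 * (I x + ennreal (e powr p))"
    by fastforce+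
  let ?B0 = "interp_space X Y s p" and ?B1 = "interp_space X Y (1 - s) p"
  have qI: "qnorm (interp_space (sum_space X Y) (inter_space X Y) s p) x = enn2real (I x) powr (1 / p)" for x
    by (simp add: qnorm_interp_space I_def)
  have qJ: "qnorm ?B0 x = enn2real (J0 x) powr (1 / p)" "qnorm ?B1 x = enn2real (J1 x) powr (1 / p)" for x
    by (simp_all add: qnorm_interp_space J0_def J1_def)
  have cI: "x \<in> carrier (interp_space (sum_space X Y) (inter_space X Y) s p) \<longleftrightarrow> x \<in> ?S \<and> I x < \<infinity>" for x
    by (simp add: mem_carrier_interp_space I_def carrier_sum_inter)
  have cJ: "x \<in> carrier ?B0 \<longleftrightarrow> x \<in> ?S \<and> J0 x < \<infinity>" "x \<in> carrier ?B1 \<longleftrightarrow> x \<in> ?S \<and> J1 x < \<infinity>" for x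
    by (auto simp: mem_carrier_interp_space J0_def J1_def)
  have near_opt: "\<exists>a b. (x, e, a, b) \<in> near_optimal" if "x \<in> ?S" "e > 0" for x e
    by (rule K_functional_approx[OF that, of 1]) (use that in \<open>force simp: near_optimal_def\<close>)
  have fin: "a \<in> carrier ?B0" "b \<in> carrier ?B1"
    if "(x, e, a, b) \<in> near_optimal" "I x < \<infinity>" for x e a b
    using ennreal_bound_less_top[OF D0(2)[OF that(1)]] ennreal_bound_less_top[OF D1(2)[OF that(1)]]
      near_optimalD[OF that(1)] that(2) by (auto simp: cJ)
  have carrier_eq: "carrier (interp_space (sum_space X Y) (inter_space X Y) s p) = carrier (sum_space ?B0 ?B1)"
  proof (intro subset_antisym subsetI)
    fix x assume "x \<in> carrier (interp_space (sum_space X Y) (inter_space X Y) s p)"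
    then have x: "x \<in> ?S" "I x < \<infinity>" using cI by auto
    \<comment> \<open>Any positive error suffices for membership; 1 is an arbitrary choice.\<close>
    obtain a b where ab: "(x, 1, a, b) \<in> near_optimal" using near_opt[OF x(1), of 1] by auto
    show "x \<in> carrier (sum_space ?B0 ?B1)"
      using fin[OF ab x(2)] near_optimalD(4)[OF ab] unfolding mem_carrier_sum_space[of x ?B0] by blast
  next
    fix x assume "x \<in> carrier (sum_space ?B0 ?B1)"
    then obtain y z where yz: "x = y + z" "y \<in> carrier ?B0" "z \<in> carrier ?B1"
      unfolding mem_carrier_sum_space[of x ?B0] by blast
    then have "I x < \<infinity>"
      using ennreal_bound_less_top[OF D(2)[of y z]] by (simp add: cJ)
    then show "x \<in> carrier (interp_space (sum_space X Y) (inter_space X Y) s p)"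
      using yz S_add by (simp add: cI cJ)
  qed
  define c where "c = (2 * D0) powr (1 / p) + (2 * D1) powr (1 / p)"
  define c' where "c' = (2 * D) powr (1 / p)"
  have pos: "c > 0" "c' > 0" using D(1) D0(1) D1(1) by (auto simp: c_def c'_def add_pos_pos)
  show ?thesis
    unfolding equal_equiv_def
  proof (intro conjI exI ballI carrier_eq)
    show "0 < 1 / c" "0 < c'" using pos by auto
    fix x assume xc: "x \<in> carrier (interp_space (sum_space X Y) (inter_space X Y) s p)"
    then have x: "x \<in> ?S" "I x < \<infinity>" using cI by auto
    have "qnorm (sum_space ?B0 ?B1) x \<le> c * enn2real (I x) powr (1 / p)"
    proof (rule field_le_epsilon)
      fix d :: real assume "d > 0"
      \<comment> \<open>The final estimate has the error \<open>c * e\<close>, which this choice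
        makes equal to \<open>d\<close>.\<close>
      define e where "e = d / c"
      have e: "e > 0" "c * e = d" using \<open>d > 0\<close> pos by (auto simp: e_def)
      obtain a b where ab: "(x, e, a, b) \<in> near_optimal" using near_opt[OF x(1) e(1)] by auto
      have e': "enn2real (ennreal (e powr p)) powr (1 / p) = e"
        using e p by (simp add: powr_powr)
      have "qnorm (sum_space ?B0 ?B1) x \<le> qnorm ?B0 a + 1 * qnorm ?B1 b"
        unfolding qnorm_sum_space near_optimalD(4)[OF ab]
        using fin[OF ab x(2)] by (intro K_functional_le qnorm_nonneg_interp_space) auto
      also have "\<dots> \<le> (2 * D0) powr (1 / p) * (enn2real (I x) powr (1 / p) + e)
          + (2 * D1) powr (1 / p) * (enn2real (I x) powr (1 / p) + e)"
        using enn2real_powr_le[OF D0(2)[OF ab] x(2) _ _ p] enn2real_powr_le[OF D1(2)[OF ab] x(2) _ _ p]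
          D0(1) D1(1) unfolding qJ e' by (simp add: add_mono)
      also have "\<dots> = c * enn2real (I x) powr (1 / p) + c * e"
        by (simp add: c_def algebra_simps)
      finally show "qnorm (sum_space ?B0 ?B1) x \<le> c * enn2real (I x) powr (1 / p) + d"
        using e by simp
    qed
    then show "1 / c * qnorm (sum_space ?B0 ?B1) x
        \<le> qnorm (interp_space (sum_space X Y) (inter_space X Y) s p) x"
      unfolding qI using pos by (simp add: field_simps)
    \<comment> \<open>The bound holds for every decomposition into \<open>?B0\<close> and
      \<open>?B1\<close>, hence for the infimum defining the norm of the sum.\<close>
    have "enn2real (I x) powr (1 / p) / c' \<le> K_functional x 1 ?B0 ?B1"
    proof (rule K_functional_greatest)
      show "x \<in> carrier (sum_space ?B0 ?B1)" using xc carrier_eq by simp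
      fix y z assume yz: "y \<in> carrier ?B0" "z \<in> carrier ?B1" "x = y + z"
      have "enn2real (I x) powr (1 / p) \<le> c' * (qnorm ?B0 y + qnorm ?B1 z)"
        unfolding qJ c'_def yz(3) using yz D p by (intro enn2real_powr_le) (auto simp: cJ)
      then show "enn2real (I x) powr (1 / p) / c' \<le> qnorm ?B0 y + 1 * qnorm ?B1 z"
        using pos by (simp add: field_simps)
    qed
    then show "qnorm (interp_space (sum_space X Y) (inter_space X Y) s p) x
        \<le> c' * qnorm (sum_space ?B0 ?B1) x"
      unfolding qI qnorm_sum_space using pos by (simp add: field_simps)
  qed
qed

end

lemma quasi_banach_couple_pair:
  assumes "quasi_banach_couple T X Y"
  obtains C where "quasi_normed_pair X Y C"
proof -
  have "quasi_banach_space X" "quasi_banach_space Y"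
    using assms by (simp_all add: quasi_banach_couple_def)
  from this[unfolded quasi_banach_space_def, THEN conjunct1]
  have n: "quasi_normed_space X" "quasi_normed_space Y" .
  obtain C where C: "C \<ge> 1" "\<And>a b. a \<in> carrier X \<Longrightarrow> b \<in> carrier X \<Longrightarrow>
        qnorm X (a + b) \<le> C * (qnorm X a + qnorm X b)"
    using n(1)[unfolded quasi_normed_space_def, THEN conjunct2, THEN conjunct2, THEN conjunct2, THEN conjunct2]
    by blast
  obtain D where D: "D \<ge> 1" "\<And>a b. a \<in> carrier Y \<Longrightarrow> b \<in> carrier Y \<Longrightarrow>
        qnorm Y (a + b) \<le> D * (qnorm Y a + qnorm Y b)"
    using n(2)[unfolded quasi_normed_space_def, THEN conjunct2, THEN conjunct2, THEN conjunct2, THEN conjunct2]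
    by blast
  \<comment> \<open>The quasi-norms are nonnegative on their carriers, so either constant may be
    enlarged to the maximum.\<close>
  have "quasi_normed_pair X Y (max C D)"
  proof
    fix a b
    show "qnorm X (a + b) \<le> max C D * (qnorm X a + qnorm X b)"
      if "a \<in> carrier X" "b \<in> carrier X"
      using that n(1) by (intro order_trans[OF C(2)] mult_right_mono)
        (auto simp: quasi_normed_space_def)
    show "qnorm Y (a + b) \<le> max C D * (qnorm Y a + qnorm Y b)"
      if "a \<in> carrier Y" "b \<in> carrier Y"
      using that n(2) by (intro order_trans[OF D(2)] mult_right_mono)
        (auto simp: quasi_normed_space_def)
  qed (use n C(1) in auto)
  then show thesis by (rule that)
qed

theorem theorem4p8:
  fixes T :: "'a::real_vector topology" and A\<^sub>0 A\<^sub>1 :: "'a qn_space" and \<theta> p :: real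
  assumes "quasi_banach_couple T A\<^sub>0 A\<^sub>1"
    and "0 < \<theta>" and "\<theta> < 1" and "0 < p"
  shows "(\<theta> \<le> 1 / 2 \<longrightarrow>
           equal_equiv (interp_space (sum_space A\<^sub>0 A\<^sub>1) (inter_space A\<^sub>0 A\<^sub>1) \<theta> p)
             (sum_space (interp_space A\<^sub>0 A\<^sub>1 \<theta> p) (interp_space A\<^sub>0 A\<^sub>1 (1 - \<theta>) p))) \<and>
         (1 / 2 \<le> \<theta> \<longrightarrow>
           equal_equiv (interp_space (sum_space A\<^sub>0 A\<^sub>1) (inter_space A\<^sub>0 A\<^sub>1) \<theta> p)
             (inter_space (interp_space A\<^sub>0 A\<^sub>1 \<theta> p) (interp_space A\<^sub>0 A\<^sub>1 (1 - \<theta>) p)))"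
proof -
  obtain C where "quasi_normed_pair A\<^sub>0 A\<^sub>1 C"
    using assms(1) by (rule quasi_banach_couple_pair)
  then interpret quasi_normed_pair A\<^sub>0 A\<^sub>1 C .
  show ?thesis
    using assms interp_sum_inter_equiv_sum interp_sum_inter_equiv_inter by blast
qed

end
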